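(* Let $n\geq 10$ and let $G\in\mathfrak{C}_{n,2}$. Then $W(G)\leq W(L_{n,n-2})$, and equality holds if and only if $G\cong L_{n,n-2}$.
   Context: All graphs are simple, finite, connected and undirected. A cut vertex of a graph is a vertex whose removal makes the graph disconnected. $\mathfrak{C}_{n,k}$ denotes the set of all connected graphs on $n$ vertices with exactly $k$ cut vertices. The Wiener index $W(G)$ is the sum of the distances $d(u,v)$ (number of edges of a shortest path) over all unordered pairs of vertices $\{u,v\}$ of $G$. $P_m$ and $C_m$ are the path and the cycle on $m$ vertices. For $3\leq g\leq n-1$, $L_{n,g}$ is the graph on $n$ vertices obtained by identifying a pendant (degree one) vertex of the path $P_{n-g+1}$ with a vertex of the cycle $C_g$. The symbol $\cong$ denotes graph isomorphism. *)

theory Defs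
  imports Graph_Theory.Graph_Theory
begin

text \<open>
  Simple finite undirected graphs are the AFP locale \<open>graph\<close>: finite, loop-free,
  symmetric digraphs without parallel arcs, so that an edge is a pair of opposite arcs.
\<close>

text \<open>For vertices in different components this is a junk value;
  it is only used on connected graphs.\<close>

definition gdist :: "('a,'b) pre_digraph \<Rightarrow> 'a \<Rightarrow> 'a \<Rightarrow> nat" where
  "gdist G u v = (LEAST k. \<exists>p. pre_digraph.apath G u p v \<and> length p = k)"

text \<open>The summand is well defined on unordered pairs since distance is symmetric:
  see \<open>gdist_commute\<close> and \<open>two_wiener_index\<close> below.\<close>

definition wiener_index :: "('a,'b) pre_digraph \<Rightarrow> nat" where
  "wiener_index G =
    (\<Sum>e\<in>{{u, v} |u v. u \<in> verts G \<and> v \<in> verts G \<and> u \<noteq> v}.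
       THE d. \<exists>u v. e = {u, v} \<and> d = gdist G u v)"

text \<open>The library's \<open>connected\<close> is false of the graph without vertices, which
  must not make the vertex of a one-vertex graph a cut vertex.\<close>

definition cut_vertex :: "('a,'b) pre_digraph \<Rightarrow> 'a \<Rightarrow> bool" where
  "cut_vertex G v \<longleftrightarrow> v \<in> verts G \<and> verts G \<noteq> {v} \<and> \<not> connected (pre_digraph.del_vert G v)"

definition graphs_with_cut_vertices :: "nat \<Rightarrow> nat \<Rightarrow> ('a,'b) pre_digraph set" where
  "graphs_with_cut_vertices n k =
    {G. graph G \<and> connected G \<and> card (verts G) = n \<and> card {v. cut_vertex G v} = k}"

definition cycle_graph :: "nat \<Rightarrow> nat pair_pre_digraph" where
  "cycle_graph m = \<lparr> pverts = {..<m},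
     parcs = {(i, j). i < m \<and> j < m \<and> (j = Suc i mod m \<or> i = Suc j mod m)} \<rparr>"

text \<open>The path on \<open>m\<close> vertices, labelled \<open>a, \<dots>, a + m - 1\<close> along the path.\<close>

definition path_graph :: "nat \<Rightarrow> nat \<Rightarrow> nat pair_pre_digraph" where
  "path_graph a m = \<lparr> pverts = {a..<a + m},
     parcs = {(i, j). i \<in> {a..<a + m} \<and> j \<in> {a..<a + m} \<and> (j = Suc i \<or> i = Suc j)} \<rparr>"

text \<open>The labels are chosen so that the cycle and the path share exactly the vertex
  \<open>g - 1\<close>, an end of the path; their union thus identifies this end with a cycle vertex.\<close>

definition lollipop :: "nat \<Rightarrow> nat \<Rightarrow> (nat, nat \<times> nat) pre_digraph" where
  "lollipop n g = union (with_proj (cycle_graph g)) (with_proj (path_graph (g - 1) (n - g + 1)))"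


section \<open>Basic properties\<close>

context wf_digraph
begin

lemma awalk_relpow:
  "(\<exists>p. awalk u p v \<and> length p = k) \<longleftrightarrow> u \<in> verts G \<and> (u, v) \<in> arcs_ends G ^^ k"
proof (induction k arbitrary: u)
  case 0
  then show ?case by (auto simp: awalk_Nil_iff)
next
  case (Suc k)
  have "(\<exists>p. awalk u p v \<and> length p = Suc k) \<longleftrightarrow>
      (\<exists>e q. awalk u (e # q) v \<and> length q = k)"
    by (metis length_Suc_conv)
  also have "\<dots> \<longleftrightarrow> (\<exists>e\<in>arcs G. u = tail G e \<and> (\<exists>q. awalk (head G e) q v \<and> length q = k))"
    by (auto simp: awalk_Cons_iff)
  also have "\<dots> \<longleftrightarrow> (\<exists>e\<in>arcs G. u = tail G e \<and> (head G e, v) \<in> arcs_ends G ^^ k)"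
    unfolding Suc.IH by auto
  also have "\<dots> \<longleftrightarrow> u \<in> verts G \<and> (u, v) \<in> arcs_ends G ^^ Suc k"
    by (auto simp: relpow_commute[symmetric] arcs_ends_def arc_to_ends_def
        intro: relpow_Suc_I2 elim!: relpow_Suc_E2)
  finally show ?case .
qed

lemma gdist_eq_walk: "gdist G u v = (LEAST k. \<exists>p. awalk u p v \<and> length p = k)"
proof -
  have "(LEAST k. \<exists>p. awalk u p v \<and> length p = k) = (LEAST k. \<exists>p. apath u p v \<and> length p = k)"
  proof (cases "\<exists>p. awalk u p v")
    case True
    then obtain p where "apath u p v"
      by (auto intro: apath_awalk_to_apath)
    then have ex: "\<exists>k p. apath u p v \<and> length p = k"
      by blast
    then obtain p where p: "apath u p v" "length p = (LEAST k. \<exists>p. apath u p v \<and> length p = k)"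
      using LeastI_ex[OF ex] by blast
    show ?thesis
    proof (rule Least_equality)
      show "\<exists>q. awalk u q v \<and> length q = (LEAST k. \<exists>p. apath u p v \<and> length p = k)"
        using p by (auto simp: apath_def)
    next
      fix k assume "\<exists>q. awalk u q v \<and> length q = k"
      then obtain q where q: "awalk u q v" "length q = k" by blast
      have "length (awalk_to_apath q) \<le> length q"
        using q(1)
      proof (induct rule: awalk_to_apath_induct)
        case (path p)
        then show ?case by (auto simp: awalk_to_apath.simps)
      next
        case (decomp p q r s)
        then have "is_awalk_cyc_decomp p (q, r, s)"
          by (metis awalk_cyc_decomp_has_prop)
        with decomp step_awalk_to_apath[of u p v q r s] show ?case by auto
      qed
      moreover have "apath u (awalk_to_apath q) v"
        using q(1) by (rule apath_awalk_to_apath)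
      ultimately show "(LEAST k. \<exists>p. apath u p v \<and> length p = k) \<le> k"
        using q(2) by (auto intro: Least_le order_trans)
    qed
  next
    case False
    then show ?thesis by (simp add: apath_def)
  qed
  then show ?thesis by (simp add: gdist_def)
qed

lemma gdist_eq_mu:
  assumes "u \<rightarrow>\<^sup>* v"
  shows "\<mu> (\<lambda>_. 1) u v = ereal (real (gdist G u v))"
proof -
  have cost: "awalk_cost (\<lambda>_. 1) p = real (length p)" for p
    by (induction p) auto
  have "\<exists>k p. awalk u p v \<and> length p = k"
    using assms by (simp add: reachable_awalk)
  then obtain p where p: "awalk u p v" "length p = gdist G u v"
    unfolding gdist_eq_walk using LeastI_ex by smt
  show ?thesis
    unfolding \<mu>_def cost
  proof (rule antisym)
    show "(INF p\<in>{p. awalk u p v}. ereal (real (length p))) \<le> ereal (real (gdist G u v))"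
      using p by (auto intro!: INF_lower2)
    show "ereal (real (gdist G u v)) \<le> (INF p\<in>{p. awalk u p v}. ereal (real (length p)))"
      by (auto intro!: INF_greatest Least_le simp: gdist_eq_walk)
  qed
qed

end

lemma (in sym_digraph) gdist_commute:
  assumes "u \<in> verts G" "v \<in> verts G"
  shows "gdist G u v = gdist G v u"
proof -
  have "(arcs_ends G)\<inverse> = arcs_ends G"
    using sym_arcs unfolding symmetric_def by (simp add: sym_conv_converse_eq)
  then have "(arcs_ends G ^^ k)\<inverse> = arcs_ends G ^^ k" for k
    by (induction k) (simp_all add: converse_relcomp relpow_commute[symmetric])
  then have "(u, v) \<in> arcs_ends G ^^ k \<longleftrightarrow> (v, u) \<in> arcs_ends G ^^ k" for k
    by blast
  then show ?thesis
    using assms unfolding gdist_eq_walk awalk_relpow by simp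
qed

lemma (in graph) two_wiener_index:
  "2 * wiener_index G = (\<Sum>u\<in>verts G. \<Sum>v\<in>verts G. gdist G u v)"
proof -
  let ?V = "verts G"
  let ?E = "{{u, v} |u v. u \<in> ?V \<and> v \<in> ?V \<and> u \<noteq> v}"
  let ?P = "{(u, v). u \<in> ?V \<and> v \<in> ?V \<and> u \<noteq> v}"
  let ?s = "\<lambda>(u, v). {u, v}"
  let ?d = "\<lambda>e. THE d. \<exists>u v. e = {u, v} \<and> d = gdist G u v"
  have finP: "finite ?P"
    by (rule finite_subset[of _ "?V \<times> ?V"]) auto
  have d: "?d {u, v} = gdist G u v" if "u \<in> ?V" "v \<in> ?V" for u v
    using that gdist_commute by (auto simp: doubleton_eq_iff intro!: the_equality)
  have "(\<Sum>p\<in>?P. case p of (u, v) \<Rightarrow> gdist G u v)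
      = (\<Sum>e\<in>?E. \<Sum>p\<in>{p \<in> ?P. ?s p = e}. case p of (u, v) \<Rightarrow> gdist G u v)"
  proof (rule sum.group[symmetric, OF finP])
    show "finite ?E"
      by (rule finite_subset[of _ "Pow ?V"]) auto
    show "?s ` ?P \<subseteq> ?E" by auto
  qed
  also have "\<dots> = (\<Sum>e\<in>?E. 2 * ?d e)"
  proof (rule sum.cong[OF refl])
    fix e assume "e \<in> ?E"
    then obtain u v where uv: "e = {u, v}" "u \<in> ?V" "v \<in> ?V" "u \<noteq> v" by blast
    have "{p \<in> ?P. ?s p = e} = {(u, v), (v, u)}"
      using uv by (auto simp: doubleton_eq_iff)
    then show "(\<Sum>p\<in>{p \<in> ?P. ?s p = e}. case p of (u, v) \<Rightarrow> gdist G u v) = 2 * ?d e"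
      using uv d[of u v] gdist_commute[of u v] by simp
  qed
  also have "\<dots> = 2 * wiener_index G"
    by (simp add: wiener_index_def sum_distrib_left)
  finally have "2 * wiener_index G = (\<Sum>p\<in>?P. case p of (u, v) \<Rightarrow> gdist G u v)" ..
  also have "\<dots> = (\<Sum>p\<in>?V \<times> ?V. case p of (u, v) \<Rightarrow> gdist G u v)"
  proof (rule sum.mono_neutral_left)
    have "gdist G u u = 0" if "u \<in> ?V" for u
      unfolding gdist_def using that by (auto simp: apath_Nil_iff intro!: Least_eq_0)
    then show "\<forall>p\<in>?V \<times> ?V - ?P. (case p of (u, v) \<Rightarrow> gdist G u v) = 0" by auto
  qed auto
  finally show ?thesis
    by (simp add: sum.cartesian_product)
qed

lemma verts_lollipop:
  assumes "3 \<le> g" "g \<le> n - 1"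
  shows "verts (lollipop n g) = {..<n}"
  using assms by (auto simp: lollipop_def union_def cycle_graph_def path_graph_def)

lemma graph_lollipop:
  assumes "3 \<le> g" "g \<le> n - 1"
  shows "graph (lollipop n g)"
proof
  have less: "Suc i mod g < n" for i
    using assms mod_less_divisor[of g "Suc i"] by linarith
  show "finite (arcs (lollipop n g))"
    by (rule finite_subset[of _ "{..<n} \<times> {..<n}"])
      (use assms less in \<open>auto simp: lollipop_def union_def cycle_graph_def path_graph_def\<close>)
  have "Suc i mod g \<noteq> i \<and> i \<noteq> Suc i mod g" if "i < g" for i
    using that assms by (auto simp: mod_Suc)
  then show "tail (lollipop n g) e \<noteq> head (lollipop n g) e" if "e \<in> arcs (lollipop n g)" for e
    using that by (fastforce simp: lollipop_def union_def cycle_graph_def path_graph_def)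
qed (auto simp: lollipop_def union_def cycle_graph_def path_graph_def arc_to_ends_def
    symmetric_def sym_def arcs_ends_def image_iff)

end

theory Submission
  imports Defs
begin

text \<open>
  Let \<open>\<phi> m = m\<^sup>2 div 4\<close>. If no vertex other than \<open>y\<close> is a cut vertex of a graph on \<open>m\<close> vertices,
  every distance level of \<open>y\<close> except the first and the last has at least two vertices, so the
  distances from \<open>y\<close> sum to at most \<open>\<phi> m\<close>, the value for a cycle. A graph with exactly two cut
  vertices \<open>u\<close>, \<open>v\<close> consists of a part attached at \<open>u\<close>, a block containing both, and a part attached
  at \<open>v\<close>. The sum of distances is an explicit combination of distance sums inside the three parts,
  each of which can be replaced by a cycle (or an edge) of the same order without decreasing the
  total, up to a small correction for parts with three vertices. This leaves an inequality in the
  three orders, which is strict for \<open>n \<ge> 10\<close> except when the middle block and one outer part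
  are single edges. In case of equality the remaining part is 2-regular, hence a cycle.
\<close>

section \<open>Connectivity, distance and separation inside a subset of the vertices\<close>

definition conn_on :: "'a rel \<Rightarrow> 'a set \<Rightarrow> bool" where
  "conn_on E X \<longleftrightarrow> (\<forall>x\<in>X. \<forall>y\<in>X. (x, y) \<in> (Restr E X)\<^sup>*)"

definition cut_at :: "'a rel \<Rightarrow> 'a set \<Rightarrow> 'a \<Rightarrow> bool" where
  "cut_at E X w \<longleftrightarrow> w \<in> X \<and> \<not> conn_on E (X - {w})"

text \<open>A junk value unless \<open>x\<close> and \<open>y\<close> are connected inside \<open>X\<close>.\<close>

definition dist_in :: "'a rel \<Rightarrow> 'a set \<Rightarrow> 'a \<Rightarrow> 'a \<Rightarrow> nat" where
  "dist_in E X x y = (LEAST k. (x, y) \<in> Restr E X ^^ k)"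

definition transmission :: "'a rel \<Rightarrow> 'a set \<Rightarrow> 'a \<Rightarrow> nat" where
  "transmission E X x = (\<Sum>y\<in>X. dist_in E X x y)"

definition total_dist :: "'a rel \<Rightarrow> 'a set \<Rightarrow> nat" where
  "total_dist E X = (\<Sum>x\<in>X. transmission E X x)"

text \<open>The edge relation stays fixed while the vertex set varies, so the parts cut off at
  \<open>u\<close> are subsets rather than new graphs. A part consisting of \<open>u\<close> alone
  is allowed; lemmas that must exclude it say so separately.\<close>

definition splits :: "'a rel \<Rightarrow> 'a set \<Rightarrow> 'a set \<Rightarrow> 'a set \<Rightarrow> 'a \<Rightarrow> bool" where
  "splits E X A B u \<longleftrightarrow> X = A \<union> B \<and> A \<inter> B = {u} \<and> (\<forall>x\<in>A - {u}. \<forall>y\<in>B - {u}. (x, y) \<notin> E)"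

section \<open>Level sizes\<close>

text \<open>Both sides count the pairs \<open>(x, i)\<close> with \<open>1 <= i <= f x\<close>.
  Distance sums are thereby controlled by the number of vertices at distance at least
  \<open>i\<close>.\<close>

lemma sum_eq_sum_card_ge:
  fixes f :: "'a \<Rightarrow> nat"
  assumes "finite X" and "\<And>x. x \<in> X \<Longrightarrow> f x \<le> M"
  shows "sum f X = (\<Sum>i=1..M. card {x\<in>X. i \<le> f x})"
proof -
  have "sum f X = (\<Sum>x\<in>X. \<Sum>i=1..M. if i \<le> f x then 1 else 0)"
  proof (rule sum.cong[OF refl])
    fix x assume "x \<in> X"
    then have "{i\<in>{1..M}. i \<le> f x} = {1..f x}"
      using assms(2)[of x] by auto
    then show "f x = (\<Sum>i=1..M. if i \<le> f x then 1 else 0)"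
      by (simp add: sum.If_cases Int_def)
  qed
  also have "\<dots> = (\<Sum>i=1..M. \<Sum>x\<in>X. if i \<le> f x then 1 else 0)"
    by (rule sum.swap)
  also have "\<dots> = (\<Sum>i=1..M. card {x\<in>X. i \<le> f x})"
    using assms(1) by (simp add: sum.If_cases Int_def)
  finally show ?thesis .
qed

text \<open>The summand is what remains of \<open>m\<close> vertices after one for level 0 and two
  for each of the levels 1 to \<open>i - 1\<close>. Under \<open>2 * M <= m\<close> no subtraction
  truncates.\<close>

lemma sum_odd_gaps:
  "2 * M \<le> m \<Longrightarrow> (\<Sum>i=1..M. m + 1 - 2 * i) = M * (m - M)" for m M :: nat
proof (induction M)
  case (Suc M)
  then obtain k where "m = 2 * M + 2 + k"
    by (metis Suc_1 add_2_eq_Suc' le_add_diff_inverse mult_Suc_right add.commute)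
  with Suc show ?case by (simp add: algebra_simps)
qed simp

lemma mult_diff_le_square_div_4: "M * (m - M) \<le> m\<^sup>2 div 4" for m M :: nat
proof (cases "M \<le> m")
  case True
  then obtain k where m: "m = M + k" using le_Suc_ex by blast
  have "4 * (M * k) \<le> (M + k)\<^sup>2"
    using sum_squares_ge_zero[of "int M - int k" 0] unfolding power2_eq_square of_nat_le_iff[symmetric, where 'a=int]
    by (simp add: algebra_simps)
  then show ?thesis using m by simp
qed simp

lemma half_mult_diff_half: "(m div 2) * (m - m div 2) = m\<^sup>2 div 4" for m :: nat
proof -
  consider k where "m = 2 * k" | k where "m = 2 * k + 1" by (metis oddE evenE)
  then show ?thesis
  proof cases
    case (2 k)
    have "(2 * k + 1)\<^sup>2 div 4 = k * (k + 1)"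
      by (simp add: power2_eq_square algebra_simps)
    with 2 show ?thesis by simp
  qed (simp add: power2_eq_square)
qed

lemma card_ge_Suc:
  fixes f :: "'a \<Rightarrow> nat"
  assumes "finite X"
  shows "card {x\<in>X. i \<le> f x} = card {x\<in>X. f x = i} + card {x\<in>X. Suc i \<le> f x}"
proof -
  have "{x\<in>X. i \<le> f x} = {x\<in>X. f x = i} \<union> {x\<in>X. Suc i \<le> f x}" by auto
  then show ?thesis using assms by (simp add: card_Un_disjoint disjoint_iff)
qed

text \<open>Below height \<open>i\<close> lie at least one element of level 0 and at least two on
  each level from 1 to \<open>i - 1\<close>; \<open>lev\<close> applies there because some element
  has height at least \<open>i\<close>.\<close>

lemma card_ge_le:
  fixes f :: "'a \<Rightarrow> nat"
  assumes fin: "finite X" and y: "y \<in> X" "f y = 0"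
    and lev: "\<And>i. 1 \<le> i \<Longrightarrow> \<exists>z\<in>X. i < f z \<Longrightarrow> 2 \<le> card {x\<in>X. f x = i}"
    and i: "1 \<le> i" "\<exists>z\<in>X. i \<le> f z"
  shows "card {x\<in>X. i \<le> f x} + 2 * i \<le> card X + 1"
  using i
proof (induction i rule: dec_induct)
  case base
  have "card {x\<in>X. f x = 0} \<ge> 1"
    using card_mono[of "{x\<in>X. f x = 0}" "{y}"] y fin by simp
  moreover have "card {x\<in>X. 0 \<le> f x} = card X" by simp
  ultimately show ?case using card_ge_Suc[OF fin, of 0 f] by simp
next
  case (step i)
  then have "2 \<le> card {x\<in>X. f x = i}" using lev[of i] by (simp add: Suc_le_eq)
  moreover have "card {x\<in>X. i \<le> f x} + 2 * i \<le> card X + 1"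
    using step by (auto dest: Suc_leD)
  ultimately show ?case using card_ge_Suc[OF fin, of i f] by simp
qed

text \<open>The elements of height at least \<open>f z\<close> include \<open>z\<close>, so
  \<open>card_ge_le\<close> gives \<open>2 * f z <= card X\<close>. Summing its bounds up to the
  maximal height \<open>M\<close> gives \<open>M * (card X - M)\<close>. In the equality case each
  of these bounds is attained, and the one for height 2 leaves exactly two elements for level
  1.\<close>

lemma
  fixes f :: "'a \<Rightarrow> nat"
  assumes fin: "finite X" and y: "y \<in> X" "f y = 0"
    and lev: "\<And>i. 1 \<le> i \<Longrightarrow> \<exists>z\<in>X. i < f z \<Longrightarrow> 2 \<le> card {x\<in>X. f x = i}"
  shows level_le_half: "\<And>z. z \<in> X \<Longrightarrow> f z \<le> card X div 2"
    and level_sum_le: "sum f X \<le> (card X)\<^sup>2 div 4"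
    and level_1_eq_2: "\<lbrakk>4 \<le> card X; sum f X = (card X)\<^sup>2 div 4; card {x\<in>X. f x = 0} = 1\<rbrakk> \<Longrightarrow> card {x\<in>X. f x = 1} = 2"
proof -
  show half: "f z \<le> card X div 2" if "z \<in> X" for z
  proof (cases "f z = 0")
    case False
    have "card {x\<in>X. f z \<le> f x} \<ge> 1"
      using card_mono[of "{x\<in>X. f z \<le> f x}" "{z}"] that fin by simp
    moreover have "card {x\<in>X. f z \<le> f x} + 2 * f z \<le> card X + 1"
      using card_ge_le[OF fin y lev, of "f z"] False that by auto
    ultimately show ?thesis by linarith
  qed simp
  define M where "M = Max (f ` X)"
  have M: "f x \<le> M" if "x \<in> X" for x
    using that fin by (simp add: M_def)
  obtain z where z: "z \<in> X" "f z = M"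
    using Max_in[of "f ` X"] fin y(1) unfolding M_def by fastforce
  have M2: "2 * M \<le> card X" using half[OF z(1)] z(2) by linarith
  have Ni: "card {x\<in>X. i \<le> f x} \<le> card X + 1 - 2 * i" if "i \<in> {1..M}" for i
    using card_ge_le[OF fin y lev, of i] that z by fastforce
  have s: "sum f X = (\<Sum>i=1..M. card {x\<in>X. i \<le> f x})"
    by (rule sum_eq_sum_card_ge[OF fin M])
  also have "\<dots> \<le> (\<Sum>i=1..M. card X + 1 - 2 * i)"
    by (rule sum_mono[OF Ni])
  finally have le: "sum f X \<le> M * (card X - M)"
    using sum_odd_gaps[OF M2] by simp
  then show "sum f X \<le> (card X)\<^sup>2 div 4"
    using mult_diff_le_square_div_4 order_trans by blast
  assume c4: "4 \<le> card X" and eq: "sum f X = (card X)\<^sup>2 div 4" and c0: "card {x\<in>X. f x = 0} = 1"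
  \<comment> \<open>This puts the index 2 into the range of summation: for \<open>M <= 1\<close> the
    sum is at most \<open>card X - 1\<close>, which is too small once
    \<open>card X >= 4\<close>.\<close>
  have "2 \<le> M"
  proof (rule ccontr)
    assume "\<not> 2 \<le> M"
    then have "M = 0 \<or> M = 1" by auto
    then have "M * (card X - M) \<le> card X - 1" by auto
    moreover have "4 * card X \<le> (card X)\<^sup>2" using c4 by (simp add: power2_eq_square)
    then have "card X \<le> (card X)\<^sup>2 div 4" by linarith
    ultimately show False using le eq c4 by linarith
  qed
  have "(\<Sum>i=1..M. card {x\<in>X. i \<le> f x}) = (\<Sum>i=1..M. card X + 1 - 2 * i)"
    using s eq le mult_diff_le_square_div_4[of M "card X"] sum_odd_gaps[OF M2] sum_mono[OF Ni]
    by (metis (no_types, lifting) le_antisym)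
  then have "card {x\<in>X. 2 \<le> f x} = card X + 1 - 2 * 2"
    using \<open>2 \<le> M\<close> by (intro sum_mono_inv[OF _ Ni, where i = 2]) auto
  moreover have "card {x\<in>X. 0 \<le> f x} = card X" by simp
  ultimately show "card {x\<in>X. f x = 1} = 2"
    using card_ge_Suc[OF fin, of 0 f] card_ge_Suc[OF fin, of 1 f] c0 c4
    by (simp add: numeral_2_eq_2)
qed

text \<open>The reverse count: small levels leave at least \<open>card X + 1 - 2 * i\<close>
  elements of height at least \<open>i\<close>, and these bounds are summed up to half the
  order.\<close>

lemma level_sum_ge:
  fixes f :: "'a \<Rightarrow> nat"
  assumes fin: "finite X" and c0: "card {x\<in>X. f x = 0} \<le> 1"
    and lev: "\<And>i. 1 \<le> i \<Longrightarrow> card {x\<in>X. f x = i} \<le> 2"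
  shows "(card X)\<^sup>2 div 4 \<le> sum f X"
proof -
  have N: "card X + 1 \<le> card {x\<in>X. i \<le> f x} + 2 * i" if "1 \<le> i" for i
    using that
  proof (induction i rule: dec_induct)
    case base
    have "card {x\<in>X. 0 \<le> f x} = card X" by simp
    then show ?case using card_ge_Suc[OF fin, of 0 f] c0 by simp
  next
    case (step i)
    then show ?case using card_ge_Suc[OF fin, of i f] lev[of i] by simp
  qed
  define h where "h = card X div 2"
  \<comment> \<open>Inserting \<open>h\<close> makes the range up to \<open>M\<close> contain the
    range up to \<open>h\<close>, whether or not some element has that height.\<close>
  define M where "M = Max (insert h (f ` X))"
  have M: "f x \<le> M" if "x \<in> X" for x
    using that fin by (simp add: M_def)
  have hM: "h \<le> M" using fin by (simp add: M_def)
  have "(card X)\<^sup>2 div 4 = (\<Sum>i=1..h. card X + 1 - 2 * i)"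
    using sum_odd_gaps[of h "card X"] half_mult_diff_half[of "card X"] by (simp add: h_def)
  also have "\<dots> \<le> (\<Sum>i=1..h. card {x\<in>X. i \<le> f x})"
    using N by (intro sum_mono) (simp add: le_diff_conv)
  also have "\<dots> \<le> (\<Sum>i=1..M. card {x\<in>X. i \<le> f x})"
    using hM by (intro sum_mono2) auto
  also have "\<dots> = sum f X"
    by (rule sum_eq_sum_card_ge[OF fin M, symmetric])
  finally show ?thesis .
qed

section \<open>Distances in induced subgraphs\<close>

locale symmetric_relation =
  fixes E :: "'a rel"
  assumes sym: "sym E"
begin

abbreviation "d \<equiv> dist_in E"
abbreviation "D \<equiv> transmission E"
abbreviation "S \<equiv> total_dist E"

lemma edge_sym: "(x, y) \<in> E \<longleftrightarrow> (y, x) \<in> E"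
  using sym by (auto dest: symD)

lemma relpow_sym: "(x, y) \<in> Restr E X ^^ k \<Longrightarrow> (y, x) \<in> Restr E X ^^ k"
proof (induction k arbitrary: y)
  case (Suc k)
  then obtain z where "(x, z) \<in> Restr E X ^^ k" "(z, y) \<in> Restr E X" by auto
  then have "(y, z) \<in> Restr E X" "(z, x) \<in> Restr E X ^^ k"
    using Suc.IH by (auto simp: edge_sym)
  then show ?case by (rule relpow_Suc_I2)
qed auto

lemma dist_le: "(x, y) \<in> Restr E X ^^ k \<Longrightarrow> d X x y \<le> k"
  unfolding dist_in_def by (rule Least_le)

lemma dist_path:
  assumes "conn_on E X" "x \<in> X" "y \<in> X"
  shows "(x, y) \<in> Restr E X ^^ d X x y"
proof -
  have "(x, y) \<in> (Restr E X)\<^sup>*"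
    using assms unfolding conn_on_def by blast
  then have "\<exists>k. (x, y) \<in> Restr E X ^^ k"
    using rtrancl_imp_relpow by blast
  then show ?thesis
    unfolding dist_in_def by (rule LeastI_ex)
qed

lemma dist_refl [simp]: "d X x x = 0"
  using dist_le[where x = x and y = x and k = 0] by simp

lemma dist_sym: "d X x y = d X y x"
  unfolding dist_in_def using relpow_sym by metis

lemma dist_eq_0_iff:
  assumes "conn_on E X" "x \<in> X" "y \<in> X"
  shows "d X x y = 0 \<longleftrightarrow> x = y"
  using dist_path[OF assms] by auto

lemma dist_step:
  assumes "conn_on E X" "x \<in> X" "y \<in> X" "z \<in> X" "(y, z) \<in> E"
  shows "d X x z \<le> Suc (d X x y)"
  using dist_path[OF assms(1-3)] assms(3-5) by (intro dist_le) (auto intro: relpow_Suc_I)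

lemma dist_triangle:
  assumes "conn_on E X" "x \<in> X" "y \<in> X" "z \<in> X"
  shows "d X x z \<le> d X x y + d X y z"
  using dist_path[OF assms(1-3)] dist_path[OF assms(1,3,4)]
  by (intro dist_le) (auto simp: relpow_add)

lemma dist_pred:
  assumes "conn_on E X" "x \<in> X" "z \<in> X" "d X x z = Suc k"
  obtains w where "w \<in> X" "d X x w = k" "(w, z) \<in> E"
proof -
  have "(x, z) \<in> Restr E X ^^ Suc k"
    using dist_path[OF assms(1-3)] assms(4) by simp
  then obtain w where w: "(x, w) \<in> Restr E X ^^ k" "(w, z) \<in> Restr E X"
    by auto
  moreover have "Suc k \<le> Suc (d X x w)"
    using dist_step[of X x w z] w assms by auto
  ultimately show ?thesis
    using that dist_le[OF w(1)] by auto
qed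

lemma level_0:
  assumes "conn_on E X" "y \<in> X"
  shows "{x\<in>X. d X y x = 0} = {y}"
  using assms dist_eq_0_iff[of X y] by auto

lemma level_1:
  assumes "conn_on E X" "y \<in> X"
  shows "{x\<in>X. d X y x = 1} = {x\<in>X. (y, x) \<in> E} - {y}"
proof -
  have "d X y x = 1" if "x \<in> X" "(y, x) \<in> E" "x \<noteq> y" for x
    using dist_step[of X y y x] dist_eq_0_iff[of X y x] assms that by simp
  moreover have "(y, x) \<in> E" if "x \<in> X" "d X y x = 1" for x
    using dist_pred[of X y x 0] assms that dist_eq_0_iff[of X y] by auto
  moreover have "d X y x \<noteq> 1" if "x = y" for x using that by simp
  ultimately show ?thesis by blast
qed

text \<open>Along an edge the distance from \<open>y\<close> grows by at most one, so a walk from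
  \<open>y\<close> that avoids the only vertex of level \<open>i\<close> never gets past that level
  and cannot reach \<open>z\<close>.\<close>

lemma cut_if_singleton_level:
  assumes conn: "conn_on E X" and X: "y \<in> X" "z \<in> X"
    and i: "1 \<le> i" "i < d X y z" and w: "{x\<in>X. d X y x = i} = {w}"
  shows "cut_at E X w"
proof (rule ccontr)
  have wX: "w \<in> X" "d X y w = i" using w by auto
  assume "\<not> cut_at E X w"
  then have "(y, z) \<in> (Restr E (X - {w}))\<^sup>*"
    using X i wX by (auto simp: cut_at_def conn_on_def)
  then have "d X y z < i"
  proof (induction rule: rtrancl_induct)
    case base
    show ?case using i by simp
  next
    case (step x x')
    then have "d X y x' \<le> Suc (d X y x)" "d X y x' \<noteq> i"
      using dist_step[of X y x x'] conn X w by auto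
    with step.IH show ?case by simp
  qed
  with i show False by simp
qed

text \<open>The root \<open>y\<close> may itself be a cut vertex: it lies on level 0, so it cannot
  be the single vertex of a level \<open>i >= 1\<close>.\<close>

lemma level_ge_2:
  assumes "finite X" and conn: "conn_on E X" and "y \<in> X" and nocut: "\<And>w. cut_at E X w \<Longrightarrow> w = y"
    and i: "1 \<le> i" "\<exists>z\<in>X. i < d X y z"
  shows "2 \<le> card {x\<in>X. d X y x = i}"
proof -
  obtain z where z: "z \<in> X" "i < d X y z" using i(2) by blast
  have "\<exists>x\<in>X. d X y x = j" if "j \<le> d X y z" for j
    using that
  proof (induction j rule: inc_induct)
    case (step n)
    then show ?case using dist_pred[OF conn \<open>y \<in> X\<close>] by metis
  qed (use z in auto)
  then obtain x where "x \<in> X" "d X y x = i" using z(2) less_imp_le by blast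
  then have "card {x\<in>X. d X y x = i} \<noteq> 0" using \<open>finite X\<close> by auto
  moreover have "card {x\<in>X. d X y x = i} \<noteq> 1"
  proof
    assume "card {x\<in>X. d X y x = i} = 1"
    then obtain w where w: "{x\<in>X. d X y x = i} = {w}" by (rule card_1_singletonE)
    then have "w = y" using cut_if_singleton_level[OF conn \<open>y \<in> X\<close> z(1) i(1) z(2) w] nocut by blast
    then have "d X y y = i" using w by auto
    with i(1) show False by simp
  qed
  ultimately show ?thesis by linarith
qed

lemma
  assumes "finite X" "conn_on E X" "y \<in> X" "\<And>w. cut_at E X w \<Longrightarrow> w = y"
  shows transmission_le: "D X y \<le> (card X)\<^sup>2 div 4"
    and dist_le_half: "z \<in> X \<Longrightarrow> d X y z \<le> card X div 2"
    and degree_eq_2: "\<lbrakk>4 \<le> card X; D X y = (card X)\<^sup>2 div 4\<rbrakk> \<Longrightarrow> card ({x\<in>X. (y, x) \<in> E} - {y}) = 2"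
  using level_sum_le[of X y "d X y"] level_le_half[of X y "d X y" z] level_1_eq_2[of X y "d X y"]
    level_ge_2[OF assms] assms level_0[of X y] level_1[of X y]
  by (simp_all add: transmission_def)

text \<open>Levels never grow after the first: choosing a predecessor on level \<open>i\<close> is
  injective on the next level, since a common predecessor of two vertices would have a third
  neighbour on level \<open>i - 1\<close>.\<close>

lemma transmission_ge:
  assumes fin: "finite X" and conn: "conn_on E X" and y: "y \<in> X"
    and deg: "\<And>x. x \<in> X \<Longrightarrow> card {z\<in>X. (x, z) \<in> E} \<le> 2"
  shows "(card X)\<^sup>2 div 4 \<le> D X y"
  unfolding transmission_def
proof (rule level_sum_ge[OF fin])
  show "card {x\<in>X. d X y x = 0} \<le> 1"
    using level_0[OF conn y] by simp
  show "card {x\<in>X. d X y x = i} \<le> 2" if "1 \<le> i" for i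
    using that
  proof (induction i rule: dec_induct)
    case base
    have "{x\<in>X. d X y x = 1} \<subseteq> {x\<in>X. (y, x) \<in> E}" using level_1[OF conn y] by auto
    then show ?case using fin by (intro order_trans[OF card_mono deg[OF y]]) auto
  next
    case (step i)
    define p where "p z = (SOME w. w \<in> X \<and> d X y w = i \<and> (w, z) \<in> E)" for z
    have p: "p z \<in> X \<and> d X y (p z) = i \<and> (p z, z) \<in> E" if "z \<in> X" "d X y z = Suc i" for z
      unfolding p_def using dist_pred[OF conn y that] by (rule someI_ex) metis
    have "inj_on p {x\<in>X. d X y x = Suc i}"
    proof (rule inj_onI, clarsimp)
      fix a b assume a: "a \<in> X" "d X y a = Suc i" and b: "b \<in> X" "d X y b = Suc i" and ab: "p a = p b"
      let ?w = "p a"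
      have w: "?w \<in> X" "d X y ?w = Suc (i - 1)" using p[OF a] step.hyps(1) by auto
      obtain c where c: "c \<in> X" "d X y c = i - 1" "(c, ?w) \<in> E"
        using dist_pred[OF conn y w] .
      have "{a, b, c} \<subseteq> {z\<in>X. (?w, z) \<in> E}"
        using p[OF a] p[OF b] ab c a b edge_sym by auto
      then have "card {a, b, c} \<le> 2"
        using fin by (intro order_trans[OF card_mono deg[OF w(1)]]) auto
      moreover have "c \<noteq> a" "c \<noteq> b" using a b c by auto
      ultimately show "a = b" by (auto simp: card_insert_if split: if_splits)
    qed
    moreover have "p ` {x\<in>X. d X y x = Suc i} \<subseteq> {x\<in>X. d X y x = i}" using p by auto
    ultimately have "card {x\<in>X. d X y x = Suc i} \<le> card {x\<in>X. d X y x = i}"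
      using fin by (intro card_inj_on_le) auto
    with step show ?case by simp
  qed
qed

end

section \<open>Splitting at a cut vertex\<close>

context symmetric_relation begin

lemma splits_commute: "splits E X A B u \<Longrightarrow> splits E X B A u"
  unfolding splits_def using edge_sym by blast

lemma splits_edge:
  assumes "splits E X A B u" "(x, y) \<in> E" "x \<in> A" "y \<in> B"
  shows "x = u \<or> y = u"
  using assms unfolding splits_def by blast

lemma splits_mem: "splits E X A B u \<Longrightarrow> u \<in> A \<and> u \<in> B \<and> u \<in> X"
  unfolding splits_def by blast

text \<open>Collapsing everything outside \<open>A\<close> to \<open>u\<close> turns each edge into
  an edge of \<open>A\<close> or into a stationary step, so walks are mapped to walks that are no
  longer.\<close>

lemma splits_retract:
  assumes sp: "splits E X A B u" and "(x, y) \<in> Restr E X ^^ k"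
  defines "r \<equiv> \<lambda>z. if z \<in> A then z else u"
  shows "\<exists>j\<le>k. (r x, r y) \<in> Restr E A ^^ j"
  using assms(2)
proof (induction k arbitrary: y)
  case (Suc k)
  then obtain z where z: "(x, z) \<in> Restr E X ^^ k" "(z, y) \<in> E" "z \<in> X" "y \<in> X" by auto
  obtain j where j: "j \<le> k" "(r x, r z) \<in> Restr E A ^^ j"
    using Suc.IH[OF z(1)] by blast
  show ?case
  proof (cases "z \<in> A \<and> y \<in> A")
    case True
    then have "(r x, r y) \<in> Restr E A ^^ Suc j"
      using j z by (auto simp: r_def intro: relpow_Suc_I)
    with j show ?thesis by (meson Suc_le_mono)
  next
    case False
    then have "r z = r y"
      using splits_edge[OF sp z(2)] splits_edge[OF sp edge_sym[THEN iffD1, OF z(2)]] z sp splits_mem[OF sp]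
      unfolding r_def splits_def by auto
    with j show ?thesis by (metis le_SucI)
  qed
qed auto

lemma conn_on_iff_relpow: "conn_on E X \<longleftrightarrow> (\<forall>x\<in>X. \<forall>y\<in>X. \<exists>k. (x, y) \<in> Restr E X ^^ k)"
  unfolding conn_on_def using rtrancl_imp_relpow relpow_imp_rtrancl by metis

lemma splits_conn:
  assumes "splits E X A B u" "conn_on E X"
  shows "conn_on E A"
  unfolding conn_on_iff_relpow
proof (intro ballI)
  fix x y assume xy: "x \<in> A" "y \<in> A"
  then have "x \<in> X" "y \<in> X" using assms(1) by (auto simp: splits_def)
  then obtain k where "(x, y) \<in> Restr E X ^^ k"
    using assms(2) conn_on_iff_relpow by blast
  from splits_retract[OF assms(1) this] xy show "\<exists>k. (x, y) \<in> Restr E A ^^ k" by auto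
qed

lemma relpow_Restr_mono:
  assumes "A \<subseteq> X" "(x, y) \<in> Restr E A ^^ k"
  shows "(x, y) \<in> Restr E X ^^ k"
  using assms(2)
proof (induction k arbitrary: y)
  case (Suc k)
  then obtain z where "(x, z) \<in> Restr E A ^^ k" "(z, y) \<in> Restr E A" by auto
  with Suc.IH assms(1) show ?case by (auto intro!: relpow_Suc_I[of x z])
qed auto

lemma splits_dist:
  assumes sp: "splits E X A B u" and conn: "conn_on E X" and xy: "x \<in> A" "y \<in> A"
  shows "d X x y = d A x y"
proof (rule antisym)
  have X: "x \<in> X" "y \<in> X" "A \<subseteq> X" using sp xy by (auto simp: splits_def)
  show "d X x y \<le> d A x y"
    by (intro dist_le relpow_Restr_mono[OF X(3)] dist_path splits_conn[OF sp conn] xy)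
  obtain j where "j \<le> d X x y" "(x, y) \<in> Restr E A ^^ j"
    using splits_retract[OF sp dist_path[OF conn X(1,2)]] xy by auto
  then show "d A x y \<le> d X x y" using dist_le by fastforce
qed

text \<open>A walk from \<open>A\<close> into \<open>B\<close> has to pass through \<open>u\<close>:
  the first step that leaves \<open>A\<close> starts at \<open>u\<close>. Induction on the walk
  turns this into the lower bound; the triangle inequality gives the other one.\<close>

lemma splits_dist_add:
  assumes sp: "splits E X A B u" and conn: "conn_on E X" and xy: "x \<in> A" "y \<in> B"
  shows "d X x y = d A x u + d B u y"
proof -
  have u: "u \<in> X" "u \<in> A" "u \<in> B" and AB: "A \<subseteq> X" "B \<subseteq> X" "X = A \<union> B"
    using sp by (auto simp: splits_def)
  have "d X x u + d X u y \<le> k" if "(x, y) \<in> Restr E X ^^ k" "x \<in> A" for x k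
    using that
  proof (induction k arbitrary: x)
    case 0
    then have "x = u" using sp xy(2) by (auto simp: splits_def)
    with 0 show ?case by simp
  next
    case (Suc k)
    then obtain z where z: "(x, z) \<in> E" "x \<in> X" "z \<in> X" "(z, y) \<in> Restr E X ^^ k"
      using relpow_Suc_D2 by fastforce
    show ?case
    proof (cases "z \<in> A")
      case True
      have "d X x u \<le> Suc (d X z u)"
        using dist_step[OF conn u(1) z(3,2)] z(1) edge_sym dist_sym by metis
      with Suc.IH[OF z(4) True] show ?thesis by simp
    next
      case False
      then have "x = u" using splits_edge[OF sp z(1) Suc.prems(2)] z(3) AB u(2) by blast
      moreover have "d X x y \<le> Suc k" using Suc.prems(1) by (rule dist_le)
      ultimately show ?thesis by simp
    qed
  qed
  then have "d X x u + d X u y \<le> d X x y"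
    using dist_path[OF conn, of x y] xy AB by blast
  moreover have "d X x y \<le> d X x u + d X u y"
    using dist_triangle[OF conn] xy u AB by blast
  moreover have "d X x u = d A x u" "d X u y = d B u y"
    using splits_dist[OF sp conn xy(1) u(2)] splits_dist[OF splits_commute[OF sp] conn u(3) xy(2)] by auto
  ultimately show ?thesis by simp
qed

lemma splits_transmission:
  assumes sp: "splits E X A B u" and conn: "conn_on E X" and fin: "finite X"
    and b: "card B = Suc b" and x: "x \<in> A"
  shows "D X x = D A x + b * d A x u + D B u"
proof -
  have fAB: "finite A" "finite B" using sp fin by (auto simp: splits_def)
  have X: "X = A \<union> (B - {u})" "A \<inter> (B - {u}) = {}" and u: "u \<in> B"
    using sp by (auto simp: splits_def)
  have "D X x = (\<Sum>y\<in>A. d X x y) + (\<Sum>y\<in>B - {u}. d X x y)"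
    unfolding transmission_def using X fAB by (simp add: sum.union_disjoint)
  also have "(\<Sum>y\<in>A. d X x y) = D A x"
    unfolding transmission_def by (rule sum.cong) (use splits_dist[OF sp conn x] in auto)
  also have "(\<Sum>y\<in>B - {u}. d X x y) = (\<Sum>y\<in>B - {u}. d A x u + d B u y)"
    by (rule sum.cong) (use splits_dist_add[OF sp conn x] in auto)
  also have "\<dots> = b * d A x u + (\<Sum>y\<in>B - {u}. d B u y)"
    using b u fAB by (simp add: sum.distrib)
  also have "(\<Sum>y\<in>B - {u}. d B u y) = D B u"
    unfolding transmission_def using u fAB by (simp add: sum.remove[of B u])
  finally show ?thesis by simp
qed

text \<open>A pair with one vertex on each side is joined through \<open>u\<close>. Hence
  \<open>D A u\<close> is counted once for each of the \<open>b\<close> vertices of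
  \<open>B - {u}\<close> and in both orders, and symmetrically for \<open>D B u\<close>.\<close>

lemma splits_total_dist:
  assumes sp: "splits E X A B u" and conn: "conn_on E X" and fin: "finite X"
    and a: "card A = Suc a" and b: "card B = Suc b"
  shows "S X = S A + S B + 2 * b * D A u + 2 * a * D B u"
proof -
  have fAB: "finite A" "finite B" using sp fin by (auto simp: splits_def)
  have X: "X = A \<union> (B - {u})" "A \<inter> (B - {u}) = {}" and u: "u \<in> B" "u \<in> A"
    using sp by (auto simp: splits_def)
  have part: "(\<Sum>x\<in>A. D X x) = S A + b * D A u + Suc a * D B u"
    if "splits E X A B u" "card B = Suc b" "card A = Suc a" for A B a b
  proof -
    have "(\<Sum>x\<in>A. D X x) = (\<Sum>x\<in>A. D A x + b * d A x u + D B u)"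
      by (rule sum.cong) (use splits_transmission[OF that(1) conn fin that(2)] in auto)
    also have "\<dots> = S A + b * (\<Sum>x\<in>A. d A x u) + Suc a * D B u"
      by (simp add: sum.distrib total_dist_def sum_distrib_left that(3))
    also have "(\<Sum>x\<in>A. d A x u) = D A u"
      unfolding transmission_def using dist_sym by metis
    finally show ?thesis .
  qed
  \<comment> \<open>The row of \<open>u\<close> occurs in both sums on the right, hence the extra
    \<open>D X u\<close>.\<close>
  have "S X + D X u = (\<Sum>x\<in>A. D X x) + (\<Sum>x\<in>B. D X x)"
    unfolding total_dist_def using X fAB u
    by (simp add: sum.union_disjoint sum.remove[of B u])
  moreover have "D X u = D A u + D B u"
    using splits_transmission[OF sp conn fin b u(2)] by simp
  ultimately show ?thesis
    using part[OF sp b a] part[OF splits_commute[OF sp] a b] by (simp add: algebra_simps)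
qed

lemma cut_at_splits_root:
  assumes sp: "splits E X A B u" and "A \<noteq> {u}" "B \<noteq> {u}"
  shows "cut_at E X u"
proof -
  obtain a b where a: "a \<in> A" "a \<noteq> u" and b: "b \<in> B" "b \<noteq> u"
    using splits_mem[OF sp] assms(2,3) by blast
  have "y \<in> A - {u}" if "(a, y) \<in> (Restr E (X - {u}))\<^sup>*" for y
    using that
  proof (induction rule: rtrancl_induct)
    case (step y z)
    then show ?case using splits_edge[OF sp, of y z] sp by (auto simp: splits_def)
  qed (use a in simp)
  moreover have "b \<notin> A - {u}" "a \<in> X" "b \<in> X" using sp a b by (auto simp: splits_def)
  ultimately show ?thesis
    using a b splits_mem[OF sp] unfolding cut_at_def conn_on_def by blast
qed

text \<open>Deleting \<open>w\<close> other than \<open>u\<close> from \<open>A\<close> leaves a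
  split of \<open>X - {w}\<close>, and connectivity passes to the parts of a split. This bounds the
  cut vertices of each part by those of the whole graph.\<close>

lemma cut_at_splits:
  assumes sp: "splits E X A B u" and "B \<noteq> {u}" and cut: "cut_at E A w"
  shows "cut_at E X w"
proof (cases "w = u")
  case True
  have "A \<noteq> {u}" using cut True by (auto simp: cut_at_def conn_on_def)
  with cut_at_splits_root[OF sp] assms(2) True show ?thesis by simp
next
  case False
  have w: "w \<in> A" "w \<in> X" using cut sp by (auto simp: cut_at_def splits_def)
  have "splits E (X - {w}) (A - {w}) B u"
    using sp w False by (auto simp: splits_def)
  then show ?thesis
    using splits_conn cut w by (auto simp: cut_at_def)
qed

text \<open>\<open>B\<close> is the component of \<open>v\<close> in \<open>X - {u}\<close> together
  with \<open>u\<close>. Taking a single component keeps \<open>B - {u}\<close> connected, so that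
  \<open>u\<close> is no cut vertex of \<open>B\<close>.\<close>

lemma obtain_split:
  assumes conn: "conn_on E X" and cut: "cut_at E X u" and v: "v \<in> X" "v \<noteq> u"
  obtains A B where "splits E X A B u" "v \<in> B" "v \<notin> A" "A \<noteq> {u}" "B \<noteq> {u}" "conn_on E (B - {u})"
proof -
  define C where "C = {y. (v, y) \<in> (Restr E (X - {u}))\<^sup>*}"
  have CX: "C \<subseteq> X - {u}"
  proof
    fix y assume "y \<in> C"
    then have "(v, y) \<in> (Restr E (X - {u}))\<^sup>*" by (simp add: C_def)
    then show "y \<in> X - {u}" by (induction rule: rtrancl_induct) (use v in auto)
  qed
  have vC: "v \<in> C" by (simp add: C_def)
  have closed: "z \<in> C" if "y \<in> C" "(y, z) \<in> E" "z \<in> X - {u}" for y z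
  proof -
    have "(v, y) \<in> (Restr E (X - {u}))\<^sup>*" "(y, z) \<in> Restr E (X - {u})"
      using that CX by (auto simp: C_def)
    then show ?thesis unfolding C_def by (simp add: rtrancl_into_rtrancl)
  qed
  have from_v: "(v, y) \<in> (Restr E C)\<^sup>*" if "y \<in> C" for y
  proof -
    have "(v, y) \<in> (Restr E (X - {u}))\<^sup>*" using that by (simp add: C_def)
    then have "y \<in> C \<and> (v, y) \<in> (Restr E C)\<^sup>*"
    proof (induction rule: rtrancl_induct)
      case (step y z)
      then have "z \<in> C" using closed by blast
      with step show ?case by (auto intro: rtrancl_into_rtrancl)
    qed (use vC in simp)
    then show ?thesis by simp
  qed
  have connC: "conn_on E C"
    unfolding conn_on_def
  proof (intro ballI)
    fix x y assume "x \<in> C" "y \<in> C"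
    have "sym (Restr E C)" using sym by (auto simp: sym_def)
    then have "(x, v) \<in> (Restr E C)\<^sup>*"
      using from_v[OF \<open>x \<in> C\<close>] by (meson sym_rtrancl symD)
    then show "(x, y) \<in> (Restr E C)\<^sup>*"
      using from_v[OF \<open>y \<in> C\<close>] by (rule rtrancl_trans)
  qed
  have uX: "u \<in> X" using cut by (simp add: cut_at_def)
  have "C \<noteq> X - {u}" using cut connC by (auto simp: cut_at_def)
  then obtain w where "w \<in> X" "w \<noteq> u" "w \<notin> C" using CX by blast
  show ?thesis
  proof
    show "splits E X (X - C) (insert u C) u"
      using CX uX closed edge_sym unfolding splits_def by blast
    have "insert u C - {u} = C" using CX by auto
    then show "conn_on E (insert u C - {u})" using connC by simp
  qed (use vC v \<open>w \<in> X\<close> \<open>w \<noteq> u\<close> \<open>w \<notin> C\<close> in auto)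
qed

end

section \<open>Inequalities between orders of cycles\<close>

lemma four_square_div_4: "4 * (m\<^sup>2 div 4) + m mod 2 = m\<^sup>2" for m :: nat
proof -
  consider k where "m = 2 * k" | k where "m = 2 * k + 1" by (metis oddE evenE)
  then show ?thesis
  proof cases
    case (2 k)
    have "(2 * k + 1)\<^sup>2 = 4 * (k * (k + 1)) + 1" by (simp add: power2_eq_square algebra_simps)
    then have "(2 * k + 1)\<^sup>2 div 4 = k * (k + 1)" "(2 * k + 1)\<^sup>2 = 4 * (k * (k + 1)) + 1" by presburger+
    with 2 show ?thesis by simp
  qed (simp add: power2_eq_square)
qed

text \<open>The value of \<open>total_dist\<close> on a cycle of \<open>m\<close> vertices is \<open>m * (m\<^sup>2 div 4)\<close>. Joining two
  pendant vertices at the root into a triangle loses 2; this is the only exceptional case.\<close>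

lemma merge_cycles_le:
  fixes a1 a2 t :: nat
  assumes "1 \<le> a1" "1 \<le> a2" "2 \<le> t"
  defines "\<phi> \<equiv> \<lambda>m::nat. m\<^sup>2 div 4"
  defines "l \<equiv> Suc a1 * \<phi> (Suc a1) + Suc a2 * \<phi> (Suc a2) + 2 * (a2 + t) * \<phi> (Suc a1) + 2 * (a1 + t) * \<phi> (Suc a2)
       + (if a1 = 2 then 2 else 0) + (if a2 = 2 then 2 else 0)"
  defines "r \<equiv> Suc (a1 + a2) * \<phi> (Suc (a1 + a2)) + 2 * t * \<phi> (Suc (a1 + a2))"
  shows "a1 + a2 = 2 \<Longrightarrow> l \<le> r + 2" and "a1 + a2 \<noteq> 2 \<Longrightarrow> l < r"
proof -
  \<comment> \<open>Shifting by the minimal values and passing to integers leaves a polynomial in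
    nonnegative variables.\<close>
  define i j s where "i = int a1 - 1" and "j = int a2 - 1" and "s = int t - 2"
  have nn: "0 \<le> i" "0 \<le> j" "0 \<le> s" using assms(1-3) by (auto simp: i_def j_def s_def)
  have ij: "int a1 = i + 1" "int a2 = j + 1" "int t = s + 2" by (auto simp: i_def j_def s_def)
  define p q where "p = int (Suc a1 mod 2)" and "q = int (Suc a2 mod 2)"
  define o' where "o' = int (Suc (a1 + a2) mod 2)"
  have phi: "4 * int (\<phi> m) = (int m)\<^sup>2 - int (m mod 2)" for m
    using four_square_div_4[of m] unfolding \<phi>_def by (metis add_diff_cancel_right' of_nat_add of_nat_mult of_nat_numeral of_nat_power)
  have p1: "4 * int (\<phi> (Suc a1)) = (i + 2)\<^sup>2 - p" using phi[of "Suc a1"] ij by (simp add: p_def add.commute)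
  have p2: "4 * int (\<phi> (Suc a2)) = (j + 2)\<^sup>2 - q" using phi[of "Suc a2"] ij by (simp add: q_def add.commute)
  have p3: "4 * int (\<phi> (Suc (a1 + a2))) = (i + j + 3)\<^sup>2 - o'" using phi[of "Suc (a1 + a2)"] ij by (simp add: o'_def algebra_simps)
  have "4 * int l = (i + 2) * ((i + 2)\<^sup>2 - p) + (j + 2) * ((j + 2)\<^sup>2 - q) + 2 * (j + s + 3) * ((i + 2)\<^sup>2 - p)
      + 2 * (i + s + 3) * ((j + 2)\<^sup>2 - q) + (if i = 1 then 8 else 0) + (if j = 1 then 8 else 0)"
    unfolding l_def p1[symmetric] p2[symmetric] using ij by (simp add: algebra_simps)
  moreover have "4 * int r = (i + j + 3) * ((i + j + 3)\<^sup>2 - o') + 2 * (s + 2) * ((i + j + 3)\<^sup>2 - o')"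
    unfolding r_def p3[symmetric] using ij by (simp add: algebra_simps)
  \<comment> \<open>These are four times the corrections for three-vertex parts. \<open>Q\<close>
    below collects the nonlinear terms, so that only its sign matters for the linear
    estimates.\<close>
  moreover define ci cj where "ci = (if i = 1 then 8 else 0 :: int)" and "cj = (if j = 1 then 8 else 0 :: int)"
  moreover define Q where "Q = i * i * j + i * j * j + i * i + j * j + 10 * (i * j) + 4 * (s * (i * j + i + j))"
  ultimately have diff: "4 * int r - 4 * int l = (Q + 7 * i + 7 * j - 1 + 2 * s)
       + p * (i + 2 * j + 2 * s + 8) + q * (j + 2 * i + 2 * s + 8) - o' * (i + j + 2 * s + 7)
       - ci - cj"
    unfolding power2_eq_square by algebra
  show "l \<le> r + 2" if "a1 + a2 = 2"
  proof -
    have "a1 = 1" "a2 = 1" using that assms by auto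
    then show ?thesis by (simp add: l_def r_def \<phi>_def power2_eq_square)
  qed
  show "l < r" if "a1 + a2 \<noteq> 2"
  proof -
    have c8: "ci \<le> 8" "cj \<le> 8" "i \<noteq> 1 \<Longrightarrow> ci = 0" "j \<noteq> 1 \<Longrightarrow> cj = 0" by (auto simp: ci_def cj_def)
    have ij1: "1 \<le> i + j" using that ij nn by linarith
    have prods: "0 \<le> Q" using nn by (simp add: Q_def)
    have ip: "even a1 \<Longrightarrow> 1 \<le> i" "even a2 \<Longrightarrow> 1 \<le> j" "odd a1 \<Longrightarrow> i \<noteq> 1" "odd a2 \<Longrightarrow> j \<noteq> 1"
      using ij nn by presburger+
    have "0 < 4 * int r - 4 * int l"
    proof (cases "even a1"; cases "even a2")
      assume e: "even a1" "even a2"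
      then have par: "p = 1" "q = 1" "o' = 1" by (auto simp: p_def q_def o'_def mod_Suc elim!: evenE)
      show ?thesis unfolding diff par using prods nn c8 ip e by (smt (verit))
    next
      assume e: "even a1" "odd a2"
      then have par: "p = 1" "q = 0" "o' = 0" by (auto simp: p_def q_def o'_def mod_Suc elim!: evenE oddE)
      show ?thesis unfolding diff par using prods nn c8 ip e by (smt (verit))
    next
      assume e: "odd a1" "even a2"
      then have par: "p = 0" "q = 1" "o' = 0" by (auto simp: p_def q_def o'_def mod_Suc elim!: evenE oddE)
      show ?thesis unfolding diff par using prods nn c8 ip e by (smt (verit))
    next
      assume e: "odd a1" "odd a2"
      \<comment> \<open>Here the parity term of the merged cycle is subtracted with nothing to
        offset it; \<open>1 <= i + j\<close> would be too weak, and evenness improves it to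
        2.\<close>
      then have "even (i + j)" by (auto simp: i_def j_def)
      then have "2 \<le> i + j" using ij1 by presburger
      moreover have par: "p = 0" "q = 0" "o' = 1"
        using e by (auto simp: p_def q_def o'_def mod_Suc elim!: oddE)
      ultimately show ?thesis unfolding diff par using prods nn c8 ip e by (smt (verit))
    qed
    then show ?thesis by linarith
  qed
qed

text \<open>A cycle on \<open>Suc b\<close> vertices carrying cycles on \<open>Suc a\<close> and \<open>Suc c\<close> vertices at antipodal
  vertices, compared with the cycle on \<open>m\<close> vertices with a tail of length 2. Replacing
  \<open>4 * (x\<^sup>2 div 4)\<close> by \<open>x\<^sup>2 - x mod 2\<close> turns the difference of the two sides into a polynomial
  \<open>?\<Delta>\<close> plus a nonnegative parity contribution.\<close>

lemma three_cycles_le: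
  fixes a b c n m :: nat
  assumes "1 \<le> a" "1 \<le> b" "1 \<le> c" and n: "a + Suc b + c = n" "10 \<le> n" and m: "m + 2 = n"
  defines "\<phi> \<equiv> \<lambda>m::nat. m\<^sup>2 div 4"
  defines "l \<equiv> Suc a * \<phi> (Suc a) + Suc b * \<phi> (Suc b) + Suc c * \<phi> (Suc c)
       + 2 * (b + c) * \<phi> (Suc a) + 2 * (a + c) * \<phi> (Suc b) + 2 * (b + a) * \<phi> (Suc c)
       + 2 * a * c * (Suc b div 2) + (if a = 2 then 2 else 0) + (if c = 2 then 2 else 0)"
  defines "r \<equiv> (m + 4) * \<phi> m + 6 * m + 2"
  shows "l \<le> r" and "l = r \<Longrightarrow> b = 1 \<and> (a = 1 \<or> c = 1)"
proof -
  define i j k where "i = int a - 1" and "j = int b - 1" and "k = int c - 1"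
  have nn: "0 \<le> i" "0 \<le> j" "0 \<le> k" using assms(1-3) by (auto simp: i_def j_def k_def)
  have ijk: "int a = i + 1" "int b = j + 1" "int c = k + 1" "int m = i + j + k + 2"
    using n m by (auto simp: i_def j_def k_def)
  \<comment> \<open>The assumption \<open>10 <= n\<close> enters the comparison here.\<close>
  have M: "6 \<le> i + j + k" using ijk n m by linarith
  define p q u s where "p = int (Suc a mod 2)" and "q = int (Suc b mod 2)" and "u = int (Suc c mod 2)" and "s = int (m mod 2)"
  have phi: "4 * int (\<phi> m) = (int m)\<^sup>2 - int (m mod 2)" for m
    using four_square_div_4[of m] unfolding \<phi>_def
    by (metis add_diff_cancel_right' of_nat_add of_nat_mult of_nat_numeral of_nat_power)
  have pa: "4 * int (\<phi> (Suc a)) = (i + 2)\<^sup>2 - p" using phi[of "Suc a"] ijk by (simp add: p_def add.commute)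
  have pb: "4 * int (\<phi> (Suc b)) = (j + 2)\<^sup>2 - q" using phi[of "Suc b"] ijk by (simp add: q_def add.commute)
  have pc: "4 * int (\<phi> (Suc c)) = (k + 2)\<^sup>2 - u" using phi[of "Suc c"] ijk by (simp add: u_def add.commute)
  have pm: "4 * int (\<phi> m) = (i + j + k + 2)\<^sup>2 - s" using phi[of m] ijk by (simp add: s_def)
  have half: "2 * int (Suc b div 2) = j + 2 - q" using ijk(2) unfolding q_def by presburger
  define ci ck where "ci = (if i = 1 then 8 else 0 :: int)" and "ck = (if k = 1 then 8 else 0 :: int)"
  have L: "4 * int l = (i + 2) * ((i + 2)\<^sup>2 - p) + (j + 2) * ((j + 2)\<^sup>2 - q) + (k + 2) * ((k + 2)\<^sup>2 - u)
      + 2 * (j + k + 2) * ((i + 2)\<^sup>2 - p) + 2 * (i + k + 2) * ((j + 2)\<^sup>2 - q) + 2 * (i + j + 2) * ((k + 2)\<^sup>2 - u)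
      + 4 * (i + 1) * (k + 1) * (j + 2 - q) + ci + ck"
    unfolding ci_def ck_def l_def pa[symmetric] pb[symmetric] pc[symmetric] half[symmetric] using ijk by (simp add: algebra_simps)
  have R: "4 * int r = (i + j + k + 6) * ((i + j + k + 2)\<^sup>2 - s) + 24 * (i + j + k + 2) + 8"
    unfolding r_def pm[symmetric] using ijk by (simp add: algebra_simps)
  have diff: "4 * int r - 4 * int l = (4 * j + (i + k) * j * (i + j + k) + (i + k - 4) * (i * k))
       + (p * (i + 2 * j + 2 * k + 6) + q * (2 * i + j + 2 * k + 6) + u * (2 * i + 2 * j + k + 6)
       + 4 * ((i + 1) * (k + 1) * q) - s * (i + j + k + 6))
       - ci - ck" (is "_ = ?\<Delta> + ?par - _ - _")
    unfolding L R by (simp add: power2_eq_square algebra_simps)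
  have pq: "p = 0 \<or> p = 1" "q = 0 \<or> q = 1" "u = 0 \<or> u = 1"
    unfolding p_def q_def u_def by auto
  \<comment> \<open>The three orders add up to \<open>m + 4\<close>, so their parities determine
    that of \<open>m\<close>.\<close>
  have "(p + q + u) mod 2 = (int (Suc a) + int (Suc b) + int (Suc c)) mod 2"
  proof -
    have "(x mod 2 + y mod 2 + z mod 2) mod 2 = (x + y + z) mod 2" for x y z :: int by presburger
    then show ?thesis unfolding p_def q_def u_def zmod_int by simp
  qed
  also have "int (Suc a) + int (Suc b) + int (Suc c) = int m + 2 * 2" using ijk by simp
  also have "(int m + 2 * 2) mod 2 = int m mod 2" by (rule mod_mult_self2)
  finally have s: "s = (p + q + u) mod 2" by (simp add: s_def zmod_int)
  have pu: "i = 1 \<Longrightarrow> p = 1" "k = 1 \<Longrightarrow> u = 1"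
    using ijk unfolding p_def u_def by presburger+
  have "0 \<le> (i + 1) * (k + 1) * q" using nn pq by auto
  moreover define W where "W = (i + 1) * (k + 1) * q"
  ultimately have W: "0 \<le> W" by simp
  \<comment> \<open>One three-vertex outer part costs 8, outweighed by this 5 together with
    \<open>8 <= ?\<Delta>\<close> from \<open>delta1\<close>. Two of them cost 16, which the parity
    contribution covers alone.\<close>
  have par: "0 \<le> ?par" "i = 1 \<Longrightarrow> 5 \<le> ?par" "k = 1 \<Longrightarrow> 5 \<le> ?par"
      "i = 1 \<Longrightarrow> k = 1 \<Longrightarrow> 16 \<le> ?par"
    unfolding s W_def[symmetric] using pq pu nn M W
    by (elim disjE; simp; linarith)+
  have delta: "0 < ?\<Delta> \<or> (j = 0 \<and> i * k = 0 \<and> ?\<Delta> = 0)"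
  proof (cases "j = 0")
    case True
    show ?thesis
    proof (cases "i * k = 0")
      case False
      then have "0 < i * k" using nn by (simp add: zero_less_mult_iff)
      moreover have "0 < i + k - 4" using M True by simp
      ultimately have "0 < (i + k - 4) * (i * k)" by (rule mult_pos_pos[rotated])
      then show ?thesis using True by simp
    qed (use True in simp)
  next
    case False
    \<comment> \<open>The product can be negative only for small \<open>i\<close> and
      \<open>k\<close>; it stays above -4, and \<open>4 * j\<close> absorbs it.\<close>
    have "- 4 < (i + k - 4) * (i * k)"
    proof (cases "4 \<le> i + k")
      case True
      then have "0 \<le> (i + k - 4) * (i * k)" using nn by (intro mult_nonneg_nonneg) auto
      then show ?thesis by simp
    next
      case False
      then have "i \<in> {0, 1, 2, 3}" "k \<in> {0, 1, 2, 3}" using nn by auto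
      with False show ?thesis by auto
    qed
    moreover have "0 \<le> (i + k) * j * (i + j + k)" using nn by simp
    ultimately show ?thesis using False nn by linarith
  qed
  \<comment> \<open>This is \<open>?\<Delta>\<close> at \<open>i = 1\<close>; since
    \<open>?\<Delta>\<close> is symmetric in \<open>i\<close> and \<open>k\<close>, it also serves
    for \<open>k = 1\<close>.\<close>
  have eight: "8 \<le> 4 * j + (1 + k) * j * (1 + j + k) + (1 + k - 4) * k" if "0 \<le> k" "5 \<le> j + k" for k :: int
  proof (cases "j = 0")
    case True
    then have "2 * 5 \<le> (1 + k - 4) * k" using that by (intro mult_mono) auto
    then show ?thesis using True by simp
  next
    case False
    have "1 * 1 * 6 \<le> (1 + k) * j * (1 + j + k)" using False nn that by (intro mult_mono) auto
    moreover have "- 2 \<le> (1 + k - 4) * k"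
    proof (cases "3 \<le> k")
      case True
      then have "0 \<le> (1 + k - 4) * k" by (intro mult_nonneg_nonneg) auto
      then show ?thesis by simp
    next
      case False
      then have "k \<in> {0, 1, 2}" using that by auto
      then show ?thesis by auto
    qed
    ultimately show ?thesis using False nn by linarith
  qed
  have delta1: "8 \<le> ?\<Delta>" if "i = 1 \<or> k = 1"
    using that eight[of k] eight[of i] nn M by (auto simp: algebra_simps)
  have ck: "ci \<le> 8" "ck \<le> 8" "i = 1 \<or> ci = 0" "k = 1 \<or> ck = 0"
    by (auto simp: ci_def ck_def)
  have fin: "?\<Delta> \<le> 4 * int r - 4 * int l \<or> 0 < 4 * int r - 4 * int l"
    unfolding diff using par delta1 ck by (smt (verit))
  then show "l \<le> r" using delta by linarith
  show "b = 1 \<and> (a = 1 \<or> c = 1)" if "l = r"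
  proof -
    have "j = 0 \<and> i * k = 0" using fin delta that by linarith
    then show ?thesis using ijk by auto
  qed
qed

section \<open>Graphs with two cut vertices\<close>

context symmetric_relation begin

text \<open>\<open>a\<close> and \<open>b\<close> count the vertices other than the shared one,
  which keeps truncated subtraction out of the later formulas.\<close>

lemma splits_card:
  assumes sp: "splits E X A B u" and fin: "finite X" and "A \<noteq> {u}" "B \<noteq> {u}"
  obtains a b where "card A = Suc a" "card B = Suc b" "1 \<le> a" "1 \<le> b" "card X = Suc (a + b)"
proof -
  have f: "finite A" "finite B" "u \<in> A" "u \<in> B" "X = A \<union> (B - {u})" "A \<inter> (B - {u}) = {}"
    using sp fin by (auto simp: splits_def)
  have "A - {u} \<noteq> {}" "B - {u} \<noteq> {}" using assms(3,4) f by auto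
  then have "1 \<le> card (A - {u})" "1 \<le> card (B - {u})" using f(1,2) by (metis One_nat_def Suc_leI card_gt_0_iff finite_Diff)+
  moreover have "card A = Suc (card (A - {u}))" "card B = Suc (card (B - {u}))"
    using f by (metis card_Suc_Diff1)+
  moreover have "card X = card A + card (B - {u})"
    using f by (simp add: card_Un_disjoint)
  ultimately show ?thesis using that by simp
qed

text \<open>The extra weight \<open>t\<close> on the root makes the induction go through: for either part of
  a split at the root, the other part is additional weight sitting at the root.\<close>

lemma rooted_total_dist:
  assumes "finite X" "conn_on E X" "u \<in> X" "\<And>w. cut_at E X w \<Longrightarrow> w = u"
    and "card X = Suc a" "1 \<le> a" "2 \<le> t"
  shows "S X + 2 * t * D X u \<le> Suc a * ((Suc a)\<^sup>2 div 4) + 2 * t * ((Suc a)\<^sup>2 div 4) + (if a = 2 then 2 else 0) \<and>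
    (cut_at E X u \<longrightarrow> a \<noteq> 2 \<longrightarrow> S X + 2 * t * D X u < Suc a * ((Suc a)\<^sup>2 div 4) + 2 * t * ((Suc a)\<^sup>2 div 4))"
  using assms
proof (induction a arbitrary: X t rule: less_induct)
  case (less a)
  show ?case
  proof (cases "cut_at E X u")
    case False
    then have "\<not> cut_at E X w" for w using less.prems(4) by blast
    then have le: "D X y \<le> (Suc a)\<^sup>2 div 4" if "y \<in> X" for y
      using transmission_le[OF less.prems(1,2) that] less.prems(5) by simp
    then have "S X \<le> Suc a * ((Suc a)\<^sup>2 div 4)"
      unfolding total_dist_def using sum_bounded_above[of X "D X"] less.prems(5) by simp
    then show ?thesis using le[OF less.prems(3)] False by (simp add: add_mono trans_le_add1)
  next
    case True
    have "X \<noteq> {u}" using less.prems(5,6) by auto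
    then obtain v where v: "v \<in> X" "v \<noteq> u" using less.prems(3) by blast
    obtain A B where sp: "splits E X A B u" "A \<noteq> {u}" "B \<noteq> {u}"
      using obtain_split[OF less.prems(2) True v] by metis
    obtain a1 a2 where c: "card A = Suc a1" "card B = Suc a2" "1 \<le> a1" "1 \<le> a2" "card X = Suc (a1 + a2)"
      using splits_card[OF sp(1) less.prems(1) sp(2,3)] .
    then have a: "a = a1 + a2" using less.prems(5) by simp
    note sp' = splits_commute[OF sp(1)]
    have f: "finite A" "finite B" "u \<in> A" "u \<in> B"
      using sp(1) less.prems(1) by (auto simp: splits_def)
    have A: "S A + 2 * (a2 + t) * D A u \<le> Suc a1 * ((Suc a1)\<^sup>2 div 4) + 2 * (a2 + t) * ((Suc a1)\<^sup>2 div 4) + (if a1 = 2 then 2 else 0)"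
      using less.IH[of a1 A "a2 + t"] f c a less.prems(4,7) splits_conn[OF sp(1) less.prems(2)]
        cut_at_splits[OF sp(1,3)] by simp
    have B: "S B + 2 * (a1 + t) * D B u \<le> Suc a2 * ((Suc a2)\<^sup>2 div 4) + 2 * (a1 + t) * ((Suc a2)\<^sup>2 div 4) + (if a2 = 2 then 2 else 0)"
      using less.IH[of a2 B "a1 + t"] f c a less.prems(4,7) splits_conn[OF sp' less.prems(2)]
        cut_at_splits[OF sp' sp(2)] by simp
    have "D X u = D A u + D B u"
      using splits_transmission[OF sp(1) less.prems(2,1) c(2) f(3)] by simp
    then have "S X + 2 * t * D X u = (S A + 2 * (a2 + t) * D A u) + (S B + 2 * (a1 + t) * D B u)"
      using splits_total_dist[OF sp(1) less.prems(2,1) c(1,2)] by (simp add: algebra_simps)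
    then show ?thesis
      using A B merge_cycles_le[OF c(3,4) less.prems(7)] a by auto
  qed
qed

text \<open>A cut vertex at \<open>u\<close> would make the bound strict. Without cut vertices every
  transmission is at most the cycle value, so equality of the totals makes each of them extremal,
  and then \<open>degree_eq_2\<close> applies.\<close>

lemma rooted_total_dist_eq:
  assumes "finite X" "conn_on E X" "u \<in> X" "\<And>w. cut_at E X w \<Longrightarrow> w = u"
    and "card X = Suc a" "3 \<le> a" "2 \<le> t"
    and eq: "S X + 2 * t * D X u = Suc a * ((Suc a)\<^sup>2 div 4) + 2 * t * ((Suc a)\<^sup>2 div 4)"
    and "y \<in> X"
  shows "card ({x\<in>X. (y, x) \<in> E} - {y}) = 2"
proof -
  have "\<not> cut_at E X u"
    using rooted_total_dist[OF assms(1-5), of t] assms(6,7) eq by auto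
  then have nocut: "\<not> cut_at E X w" for w using assms(4) by blast
  have le: "D X y \<le> (Suc a)\<^sup>2 div 4" if "y \<in> X" for y
    using transmission_le[OF assms(1,2) that] nocut assms(5) by simp
  have "D X y = (Suc a)\<^sup>2 div 4"
  proof (rule ccontr)
    assume "D X y \<noteq> (Suc a)\<^sup>2 div 4"
    then have "D X y < (Suc a)\<^sup>2 div 4" using le[OF \<open>y \<in> X\<close>] by simp
    then have "S X < (\<Sum>x\<in>X. (Suc a)\<^sup>2 div 4)"
      unfolding total_dist_def using assms(1) le \<open>y \<in> X\<close> by (intro sum_strict_mono_ex1) auto
    then have "S X < Suc a * ((Suc a)\<^sup>2 div 4)" using assms(5) by simp
    moreover have "2 * t * D X u \<le> 2 * t * ((Suc a)\<^sup>2 div 4)" using le[OF assms(3)] by simp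
    ultimately show False using eq by linarith
  qed
  then show ?thesis
    using degree_eq_2[OF assms(1,2,9)] nocut assms(5,6) by simp
qed

text \<open>This is the extremal graph up to labelling: a cycle on \<open>A\<close> with the path
  \<open>u\<close>, \<open>v\<close>, \<open>e\<close> hanging at \<open>u\<close>. The cycle is
  expressed as connectedness plus two-regularity, the form in which the equality case delivers
  it.\<close>

definition cycle_with_tail :: "'a set \<Rightarrow> 'a set \<Rightarrow> 'a \<Rightarrow> 'a \<Rightarrow> 'a \<Rightarrow> bool" where
  "cycle_with_tail X A u v e \<longleftrightarrow> X = insert v (insert e A) \<and> u \<in> A \<and> v \<notin> A \<and> e \<notin> A \<and> v \<noteq> e \<and>
    conn_on E A \<and> (\<forall>y\<in>A. card ({x\<in>A. (y, x) \<in> E} - {y}) = 2) \<and>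
    (\<forall>x\<in>A. ((x, v) \<in> E \<longleftrightarrow> x = u) \<and> (x, e) \<notin> E) \<and> (v, e) \<in> E"

lemma conn_on_pair:
  assumes "conn_on E {u, v}" "u \<noteq> v"
  shows "(u, v) \<in> E"
proof -
  have "(u, v) \<in> (Restr E {u, v})\<^sup>*" using assms(1) by (simp add: conn_on_def)
  then have "v = u \<or> (u, v) \<in> E"
    by (induction rule: rtrancl_induct) auto
  then show ?thesis using assms(2) by auto
qed

text \<open>The formula for one split is applied twice. The term with \<open>d B u v\<close>
  accounts for the pairs between \<open>A\<close> and \<open>C\<close>, which cross the whole middle
  part.\<close>

lemma splits_total_dist2:
  assumes sp1: "splits E X A R u" and sp2: "splits E R B C v" and "u \<in> B"
    and conn: "conn_on E X" and fin: "finite X"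
    and card: "card A = Suc a" "card B = Suc b" "card C = Suc c" "card R = Suc (b + c)"
  shows "S X = S A + S B + S C + 2 * (b + c) * D A u + 2 * a * D B u + 2 * c * D B v
    + 2 * (b + a) * D C v + 2 * a * c * d B u v"
proof -
  have R: "conn_on E R" "finite R"
    using splits_conn[OF splits_commute[OF sp1] conn] sp1 fin by (auto simp: splits_def)
  show ?thesis
    using splits_total_dist[OF sp1 conn fin card(1,4)] splits_total_dist[OF sp2 R card(2,3)]
      splits_transmission[OF sp2 R card(3) \<open>u \<in> B\<close>] by (simp add: algebra_simps)
qed

text \<open>Reads the chain of three parts from its other end, so that an edge as first part can be
  treated like an edge as last part.\<close>

lemma splits_rotate:
  assumes "splits E X A R u" "splits E R B C v" "u \<in> B" "u \<noteq> v"
  shows "splits E X C (A \<union> B) v" "splits E (A \<union> B) B A u"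
  using assms edge_sym unfolding splits_def by blast+

lemma cycle_with_tailI:
  assumes fin: "finite X" and conn: "conn_on E X"
    and sp1: "splits E X A R u" and sp2: "splits E R B C v" and u: "u \<in> B" "u \<noteq> v"
    and card: "card B = 2" "card C = 2" and deg: "\<forall>y\<in>A. card ({x\<in>A. (y, x) \<in> E} - {y}) = 2"
  shows "\<exists>e. cycle_with_tail X A u v e"
proof -
  note connR = splits_conn[OF splits_commute[OF sp1] conn]
  have v: "v \<in> B" "v \<in> C" using sp2 by (auto simp: splits_def)
  have B: "B = {u, v}" using card(1) u v unfolding card_2_iff by auto
  obtain e where C: "C = {v, e}" "e \<noteq> v" using card(2) v unfolding card_2_iff by auto
  have uv: "(u, v) \<in> E" using conn_on_pair splits_conn[OF sp2 connR] B u by simp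
  have ve: "(v, e) \<in> E" using conn_on_pair splits_conn[OF splits_commute[OF sp2] connR] C by simp
  have R: "R = {u, v, e}" using sp2 B C by (auto simp: splits_def)
  have A: "X = A \<union> R" "A \<inter> R = {u}" using sp1 by (auto simp: splits_def)
  have "e \<noteq> u" using sp2 B C u(2) by (auto simp: splits_def)
  have "cycle_with_tail X A u v e"
    unfolding cycle_with_tail_def
  proof (intro conjI ballI)
    show "conn_on E A" by (rule splits_conn[OF sp1 conn])
    show "(x, v) \<in> E \<longleftrightarrow> x = u" if "x \<in> A" for x
      using splits_edge[OF sp1, of x v] that uv u R by auto
    show "(x, e) \<notin> E" if "x \<in> A" for x
      using splits_edge[OF sp1, of x e] splits_edge[OF sp2, of u e] that u R B C \<open>e \<noteq> u\<close> by auto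
  qed (use A R u C ve deg \<open>e \<noteq> u\<close> in auto)
  then show ?thesis ..
qed

text \<open>The terms of \<open>splits_total_dist2\<close> are grouped by part. Each outer part is a
  rooted graph whose weight is the number of vertices outside it; the middle part has no cut vertex,
  so transmissions and the distance of \<open>u\<close> and \<open>v\<close> obey the cycle
  bounds.\<close>

lemma three_blocks:
  assumes fin: "finite X" and conn: "conn_on E X"
    and sp1: "splits E X A R u" and sp2: "splits E R B C v" and u: "u \<in> B" "u \<noteq> v"
    and ne: "A \<noteq> {u}" "C \<noteq> {v}"
    and cutA: "\<And>w. cut_at E A w \<Longrightarrow> w = u" and cutB: "\<And>w. \<not> cut_at E B w" and cutC: "\<And>w. cut_at E C w \<Longrightarrow> w = v"
    and n: "card X = m + 2" "8 \<le> m"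
  shows "S X \<le> (m + 4) * (m\<^sup>2 div 4) + 6 * m + 2"
    and "S X = (m + 4) * (m\<^sup>2 div 4) + 6 * m + 2 \<Longrightarrow> \<exists>A u v e. cycle_with_tail X A u v e"
proof -
  have R: "conn_on E R" "finite R"
    using splits_conn[OF splits_commute[OF sp1] conn] sp1 fin by (auto simp: splits_def)
  have mem: "u \<in> A" "v \<in> B" "v \<in> C" "v \<in> R" using sp1 sp2 by (auto simp: splits_def)
  have ABC: "finite A" "finite B" "finite C" "conn_on E A" "conn_on E B" "conn_on E C"
    using sp1 sp2 fin R splits_conn[OF sp1 conn] splits_conn[OF sp2 R(1)] splits_conn[OF splits_commute[OF sp2] R(1)]
    by (auto simp: splits_def)
  have "B \<noteq> {v}" "R \<noteq> {u}" using u mem by auto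
  obtain b c where bc: "card B = Suc b" "card C = Suc c" "1 \<le> b" "1 \<le> c" "card R = Suc (b + c)"
    using splits_card[OF sp2 R(2) \<open>B \<noteq> {v}\<close> ne(2)] .
  obtain a where a: "card A = Suc a" "1 \<le> a" "card X = Suc (a + (b + c))"
    using splits_card[OF sp1 fin ne(1) \<open>R \<noteq> {u}\<close>] bc(5) by (metis old.nat.inject)
  define \<phi> where "\<phi> = (\<lambda>m::nat. m\<^sup>2 div 4)"
  have tot: "S X = S A + S B + S C + 2 * (b + c) * D A u + 2 * a * D B u + 2 * c * D B v
      + 2 * (b + a) * D C v + 2 * a * c * d B u v"
    by (rule splits_total_dist2[OF sp1 sp2 u(1) conn fin a(1) bc(1,2,5)])
  have A: "S A + 2 * (b + c) * D A u \<le> Suc a * \<phi> (Suc a) + 2 * (b + c) * \<phi> (Suc a) + (if a = 2 then 2 else 0)"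
    using rooted_total_dist[OF ABC(1,4) mem(1) cutA a(1,2), of "b + c"] bc(3,4) by (simp add: \<phi>_def)
  have C: "S C + 2 * (b + a) * D C v \<le> Suc c * \<phi> (Suc c) + 2 * (b + a) * \<phi> (Suc c) + (if c = 2 then 2 else 0)"
    using rooted_total_dist[OF ABC(3,6) mem(3) cutC bc(2,4), of "b + a"] bc(3) a(2) by (simp add: \<phi>_def)
  have DB: "D B y \<le> \<phi> (Suc b)" if "y \<in> B" for y
    using transmission_le[OF ABC(2,5) that] cutB bc(1) by (simp add: \<phi>_def)
  have "S B \<le> Suc b * \<phi> (Suc b)"
    unfolding total_dist_def using sum_bounded_above[of B "D B"] DB bc(1) by simp
  moreover have "2 * a * D B u + 2 * c * D B v \<le> 2 * (a + c) * \<phi> (Suc b)"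
    unfolding distrib_left distrib_right
    by (intro add_mono mult_le_mono2 DB u mem)
  moreover have "2 * a * c * d B u v \<le> 2 * a * c * (Suc b div 2)"
    using dist_le_half[OF ABC(2,5) u(1) _ mem(2)] cutB bc(1) by simp
  ultimately have B: "S B + (2 * a * D B u + 2 * c * D B v) + 2 * a * c * d B u v
      \<le> Suc b * \<phi> (Suc b) + 2 * (a + c) * \<phi> (Suc b) + 2 * a * c * (Suc b div 2)"
    by linarith
  have abc: "a + Suc b + c = m + 2" using a(3) n(1) by simp
  define l where "l = Suc a * \<phi> (Suc a) + Suc b * \<phi> (Suc b) + Suc c * \<phi> (Suc c) +
    2 * (b + c) * \<phi> (Suc a) + 2 * (a + c) * \<phi> (Suc b) + 2 * (b + a) * \<phi> (Suc c) +
    2 * a * c * (Suc b div 2) + (if a = 2 then 2 else 0) + (if c = 2 then 2 else 0)"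
  have ten: "10 \<le> m + 2" using n(2) by simp
  have num1: "l \<le> (m + 4) * \<phi> m + 6 * m + 2"
    unfolding l_def \<phi>_def by (rule three_cycles_le(1)[OF a(2) bc(3,4) abc ten refl])
  have num2: "b = 1 \<and> (a = 1 \<or> c = 1)" if "l = (m + 4) * \<phi> m + 6 * m + 2"
    using that unfolding l_def \<phi>_def by (rule three_cycles_le(2)[OF a(2) bc(3,4) abc ten refl])
  have Sl: "S X \<le> l" using tot A B C unfolding l_def by linarith
  with num1 show "S X \<le> (m + 4) * (m\<^sup>2 div 4) + 6 * m + 2" unfolding \<phi>_def by linarith
  assume "S X = (m + 4) * (m\<^sup>2 div 4) + 6 * m + 2"
  then have SX: "S X = l" "l = (m + 4) * \<phi> m + 6 * m + 2"
    using num1 Sl unfolding \<phi>_def by linarith+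
  \<comment> \<open>The bounds for the three parts add up to \<open>l\<close>, so equality of the
    sums forces equality in each.\<close>
  have eqA: "S A + 2 * (b + c) * D A u = Suc a * \<phi> (Suc a) + 2 * (b + c) * \<phi> (Suc a) + (if a = 2 then 2 else 0)"
    and eqC: "S C + 2 * (b + a) * D C v = Suc c * \<phi> (Suc c) + 2 * (b + a) * \<phi> (Suc c) + (if c = 2 then 2 else 0)"
    using SX(1) tot A B C unfolding l_def by linarith+
  from num2[OF SX(2)] have "b = 1" and "a = 1 \<or> c = 1" by auto
  from \<open>a = 1 \<or> c = 1\<close> show "\<exists>A u v e. cycle_with_tail X A u v e"
  proof
    assume "a = 1"
    then have c3: "3 \<le> c" using abc n(2) \<open>b = 1\<close> by simp
    then have "\<forall>y\<in>C. card ({x\<in>C. (y, x) \<in> E} - {y}) = 2"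
      using rooted_total_dist_eq[OF ABC(3,6) mem(3) cutC bc(2) c3, of "b + a"] eqC a(2) bc(3) by (auto simp: \<phi>_def)
    then show ?thesis
      using cycle_with_tailI[OF fin conn splits_rotate[OF sp1 sp2 u] mem(2) u(2)[symmetric]] a(1) bc(1) \<open>a = 1\<close> \<open>b = 1\<close>
      by auto
  next
    assume "c = 1"
    then have a3: "3 \<le> a" using abc n(2) \<open>b = 1\<close> by simp
    then have "\<forall>y\<in>A. card ({x\<in>A. (y, x) \<in> E} - {y}) = 2"
      using rooted_total_dist_eq[OF ABC(1,4) mem(1) cutA a(1) a3, of "b + c"] eqA bc(3,4) by (auto simp: \<phi>_def)
    then show ?thesis
      using cycle_with_tailI[OF fin conn sp1 sp2 u] bc(1,2) \<open>c = 1\<close> \<open>b = 1\<close> by auto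
  qed
qed

text \<open>Split at \<open>u\<close> with \<open>v\<close> in \<open>R\<close>, then split
  \<open>R\<close> at \<open>v\<close> with \<open>u\<close> in \<open>B\<close>. As
  \<open>R - {u}\<close> and \<open>B - {v}\<close> are connected, neither \<open>u\<close> nor
  \<open>v\<close> is a cut vertex of \<open>B\<close>, and no other vertex can be one.\<close>

lemma two_cut_vertices:
  assumes fin: "finite X" and conn: "conn_on E X" and cuts: "{w. cut_at E X w} = {u, v}" and uv: "u \<noteq> v"
    and n: "card X = m + 2" "8 \<le> m"
  shows "S X \<le> (m + 4) * (m\<^sup>2 div 4) + 6 * m + 2"
    and "S X = (m + 4) * (m\<^sup>2 div 4) + 6 * m + 2 \<Longrightarrow> \<exists>A u v e. cycle_with_tail X A u v e"
proof -
  have cut: "cut_at E X w \<longleftrightarrow> w = u \<or> w = v" for w using cuts by blast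
  have X: "u \<in> X" "v \<in> X" using cut by (auto simp: cut_at_def)
  obtain A R where sp1: "splits E X A R u" and v: "v \<in> R" "v \<notin> A" and ne1: "A \<noteq> {u}" "R \<noteq> {u}"
    and R: "conn_on E (R - {u})"
    using obtain_split[OF conn _ X(2) uv[symmetric]] cut by metis
  note sp1' = splits_commute[OF sp1]
  have u: "u \<in> A" "u \<in> R" using sp1 by (auto simp: splits_def)
  have cutA: "w = u" if "cut_at E A w" for w
    using cut_at_splits[OF sp1 ne1(2) that] cut v(2) that by (auto simp: cut_at_def)
  have cutR: "w = v" if "cut_at E R w" for w
    using cut_at_splits[OF sp1' ne1(1) that] cut R that by (auto simp: cut_at_def)
  have connR: "conn_on E R" by (rule splits_conn[OF sp1' conn])
  have connA: "conn_on E A" by (rule splits_conn[OF sp1 conn])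
  \<comment> \<open>Otherwise every vertex other than \<open>v\<close> would reach \<open>u\<close>
    while avoiding \<open>v\<close>, either inside \<open>A\<close> or inside
    \<open>R - {v}\<close>, and \<open>v\<close> would not be a cut vertex of
    \<open>X\<close>.\<close>
  have "cut_at E R v"
  proof (rule ccontr)
    assume "\<not> cut_at E R v"
    then have Rv: "conn_on E (R - {v})" using v by (simp add: cut_at_def)
    have sub: "Restr E A \<subseteq> Restr E (X - {v})" "Restr E (R - {v}) \<subseteq> Restr E (X - {v})"
      using sp1 v by (auto simp: splits_def)
    have to_u: "(x, u) \<in> (Restr E (X - {v}))\<^sup>* \<and> (u, x) \<in> (Restr E (X - {v}))\<^sup>*" if "x \<in> X - {v}" for x
    proof (cases "x \<in> A")
      case True
      then show ?thesis using connA u rtrancl_mono[OF sub(1)] unfolding conn_on_def by blast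
    next
      case False
      then have "x \<in> R - {v}" using that sp1 by (auto simp: splits_def)
      then show ?thesis using Rv u uv rtrancl_mono[OF sub(2)] unfolding conn_on_def by blast
    qed
    have "conn_on E (X - {v})"
      unfolding conn_on_def using to_u rtrancl_trans by metis
    then show False using cut[of v] by (simp add: cut_at_def)
  qed
  then obtain C B where sp2': "splits E R C B v" and uB: "u \<in> B" and ne2: "C \<noteq> {v}" "B \<noteq> {v}"
    and Bv: "conn_on E (B - {v})"
    using obtain_split[OF connR _ u(2) uv] by metis
  note sp2 = splits_commute[OF sp2']
  have cutC: "w = v" if "cut_at E C w" for w
    using cut_at_splits[OF sp2' ne2(2) that] cutR by simp
  have cutB: "\<not> cut_at E B w" for w
    using cut_at_splits[OF sp2 ne2(1), of w] cutR[of w] Bv by (auto simp: cut_at_def)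
  note three_blocks[OF fin conn sp1 sp2 uB uv ne1(1) ne2(1) cutA cutB cutC n]
  then show "S X \<le> (m + 4) * (m\<^sup>2 div 4) + 6 * m + 2"
    and "S X = (m + 4) * (m\<^sup>2 div 4) + 6 * m + 2 \<Longrightarrow> \<exists>A u v e. cycle_with_tail X A u v e"
    by auto
qed

end

section \<open>Two-regular connected graphs\<close>

text \<open>The arcs of \<open>lollipop (m + 2) m\<close>: a cycle on the labels below
  \<open>m\<close> and the path \<open>m - 1\<close>, \<open>m\<close>,
  \<open>m + 1\<close>.\<close>

definition lollipop_rel :: "nat \<Rightarrow> nat rel" where
  "lollipop_rel m = {(i, j). i < m \<and> j < m \<and> (j = Suc i mod m \<or> i = Suc j mod m)} \<union>
    {(i, j). i \<in> {m - 1..<m + 2} \<and> j \<in> {m - 1..<m + 2} \<and> (j = Suc i \<or> i = Suc j)}"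

context symmetric_relation begin

text \<open>A longest path ending at \<open>u\<close> must close up to a cycle through all vertices.\<close>

lemma two_regular_cycle:
  assumes fin: "finite A" and conn: "conn_on E A" and u: "u \<in> A"
    and deg: "\<forall>y\<in>A. card ({x\<in>A. (y, x) \<in> E} - {y}) = 2"
  obtains xs where "distinct xs" "set xs = A" "xs \<noteq> []" "last xs = u"
    "\<And>i j. \<lbrakk>i < length xs; j < length xs; i \<noteq> j\<rbrakk> \<Longrightarrow>
      (xs ! i, xs ! j) \<in> E \<longleftrightarrow> j = Suc i mod length xs \<or> i = Suc j mod length xs"
proof -
  define N where "N y = {x\<in>A. (y, x) \<in> E} - {y}" for y
  have N2: "card (N y) = 2" if "y \<in> A" for y using deg that by (simp add: N_def)
  have finN: "finite (N y)" for y using fin by (simp add: N_def)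
  have three: False if "y \<in> A" "{p, q, r} \<subseteq> N y" "p \<noteq> q" "q \<noteq> r" "p \<noteq> r" for y p q r
    using card_mono[OF finN that(2)] N2[OF that(1)] that(3-5) by simp
  \<comment> \<open>Paths are anchored at their last vertex \<open>u\<close> and grow at the front.
    The enumeration thus ends at \<open>u\<close>, the position where the tail will be
    attached.\<close>
  define path where "path xs \<longleftrightarrow> xs \<noteq> [] \<and> distinct xs \<and> set xs \<subseteq> A \<and> last xs = u \<and>
    (\<forall>i. Suc i < length xs \<longrightarrow> (xs ! i, xs ! Suc i) \<in> E)" for xs
  have "path [u]" using u by (simp add: path_def)
  moreover have "length xs < Suc (card A)" if "path xs" for xs
    using that fin by (metis path_def distinct_card card_mono less_Suc_eq_le)
  ultimately obtain xs where xs: "path xs" and max: "\<And>ys. path ys \<Longrightarrow> length ys \<le> length xs"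
    using ex_has_greatest_nat[of path "[u]" length "Suc (card A)"] by auto
  define k where "k = length xs"
  have step: "(xs ! i, xs ! Suc i) \<in> E" if "Suc i < k" for i using xs that by (simp add: path_def k_def)
  have step': "(xs ! Suc i, xs ! i) \<in> E" if "Suc i < k" for i using step[OF that] edge_sym by blast
  have dist: "distinct xs" "set xs \<subseteq> A" "xs \<noteq> []" "last xs = u" using xs by (auto simp: path_def)
  have inA: "xs ! i \<in> A" if "i < k" for i using dist(2) that by (auto simp: k_def)
  have eq: "xs ! i = xs ! j \<longleftrightarrow> i = j" if "i < k" "j < k" for i j
    using dist(1) that by (simp add: nth_eq_iff_index_eq k_def)
  have k0: "0 < k" using dist(3) by (simp add: k_def)
  have N0: "N (xs ! 0) \<subseteq> set xs"
  proof
    fix z assume z: "z \<in> N (xs ! 0)"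
    show "z \<in> set xs"
    proof (rule ccontr)
      assume "z \<notin> set xs"
      then have "path (z # xs)"
        using xs z edge_sym[of z] by (auto simp: path_def N_def nth_Cons split: nat.split)
      from max[OF this] show False by simp
    qed
  qed
  have "N (xs ! 0) \<subseteq> set xs - {xs ! 0}" using N0 by (auto simp: N_def)
  from card_mono[OF _ this] have k3: "3 \<le> k"
    using N2[OF inA[OF k0]] dist(1) k0 by (simp add: distinct_card k_def)
  have "xs ! 1 \<in> N (xs ! 0)"
    using step[of 0] eq[of 1 0] k3 inA[of 1] by (simp add: N_def)
  moreover obtain a b where "N (xs ! 0) = {a, b}" "a \<noteq> b"
    using N2[OF inA[OF k0]] unfolding card_2_iff by blast
  ultimately obtain w where w: "w \<in> N (xs ! 0)" "w \<noteq> xs ! 1" by auto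
  obtain j where j: "w = xs ! j" "j < k"
    using w(1) N0 by (metis in_set_conv_nth k_def subsetD)
  have "j \<noteq> 0" "j \<noteq> 1" using w j by (auto simp: N_def intro: ccontr)
  \<comment> \<open>An interior vertex of the path that is also adjacent to the first one would have
    three neighbours.\<close>
  have "Suc j = k"
  proof (rule ccontr)
    assume "Suc j \<noteq> k"
    then have sj: "Suc j < k" using j by simp
    obtain i where i: "j = Suc i" using \<open>j \<noteq> 0\<close> by (cases j) auto
    have "(xs ! j, xs ! 0) \<in> E" using w j edge_sym by (auto simp: N_def)
    then have "{xs ! i, xs ! Suc j, xs ! 0} \<subseteq> N (xs ! j)"
      using step'[of i] step[OF sj] i sj k0 inA eq by (simp add: N_def)
    moreover have "i \<noteq> 0" using \<open>j \<noteq> 1\<close> i by simp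
    ultimately show False using three[OF inA[OF j(2)], of "xs ! i" "xs ! Suc j" "xs ! 0"] eq i sj k0 by simp
  qed
  then have wrap: "(xs ! (k - 1), xs ! 0) \<in> E" using w j edge_sym by (auto simp: N_def)
  have next_edge: "(xs ! i, xs ! (Suc i mod k)) \<in> E" if "i < k" for i
  proof (cases "Suc i < k")
    case False
    then have "Suc i = k" using that by simp
    then show ?thesis using wrap by auto
  qed (use step in simp)
  define prv where "prv i = (if i = 0 then k - 1 else i - 1)" for i
  have prv: "prv i < k" "Suc (prv i) mod k = i" if "i < k" for i
    using that by (auto simp: prv_def)
  \<comment> \<open>The two neighbours along the cycle exhaust the degree, so no edge leaves the
    cycle, and connectedness makes it cover \<open>A\<close>.\<close>
  have NN: "N (xs ! i) = {xs ! (Suc i mod k), xs ! prv i}" if "i < k" for i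
  proof -
    have s: "Suc i mod k < k" using k0 by simp
    have ne: "Suc i mod k \<noteq> i" "prv i \<noteq> i" "Suc i mod k \<noteq> prv i"
      using that k3 by (auto simp: prv_def mod_Suc)
    have "(xs ! i, xs ! prv i) \<in> E" using next_edge[OF prv(1)[OF that]] prv(2)[OF that] edge_sym by simp
    then have sub: "{xs ! (Suc i mod k), xs ! prv i} \<subseteq> N (xs ! i)"
      using next_edge[OF that] ne eq[OF s that] eq[OF prv(1)[OF that] that] inA[OF s] inA[OF prv(1)[OF that]]
      by (simp add: N_def)
    have "card {xs ! (Suc i mod k), xs ! prv i} = 2"
      using eq[OF s prv(1)[OF that]] ne by simp
    then show ?thesis using card_subset_eq[OF finN sub] N2[OF inA[OF that]] by simp
  qed
  have closed: "z \<in> set xs" if "y \<in> set xs" "(y, z) \<in> Restr E A" for y z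
  proof (cases "z = y")
    case False
    obtain i where i: "i < k" "y = xs ! i" using \<open>y \<in> set xs\<close> by (metis in_set_conv_nth k_def)
    have "z \<in> N (xs ! i)" using that False i by (auto simp: N_def)
    then show ?thesis using NN[OF i(1)] prv(1)[OF i(1)] k0 by (auto simp: k_def)
  qed (use that in simp)
  have "z \<in> set xs" if "z \<in> A" for z
  proof -
    have "(u, z) \<in> (Restr E A)\<^sup>*" using conn u that by (simp add: conn_on_def)
    then show ?thesis
      by (induction rule: rtrancl_induct) (use dist closed in auto)
  qed
  then have "set xs = A" using dist(2) by blast
  moreover have "(xs ! i, xs ! j) \<in> E \<longleftrightarrow> j = Suc i mod k \<or> i = Suc j mod k" if "i < k" "j < k" "i \<noteq> j" for i j
  proof -
    have "(xs ! i, xs ! j) \<in> E \<longleftrightarrow> xs ! j \<in> N (xs ! i)" using that inA eq by (simp add: N_def)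
    also have "\<dots> \<longleftrightarrow> j = Suc i mod k \<or> j = prv i"
      unfolding NN[OF that(1)] using eq[OF that(2)] prv(1)[OF that(1)] k0 by simp
    also have "j = prv i \<longleftrightarrow> i = Suc j mod k"
      using that k3 by (auto simp: prv_def mod_Suc)
    finally show ?thesis .
  qed
  ultimately show ?thesis using that dist by (simp add: k_def)
qed

end

section \<open>Comparison with the lollipop\<close>

lemma lollipop_rel_sym: "sym (lollipop_rel m)"
  by (auto simp: lollipop_rel_def sym_def)

text \<open>The cycle and both tail edges have maximum degree at most 2, so
  \<open>transmission_ge\<close> bounds their transmissions from below, and the splitting formula
  adds them up. The left side is the bound of \<open>two_cut_vertices\<close>.\<close>

lemma lollipop_total_dist_ge:
  assumes "8 \<le> m"
  shows "(m + 4) * (m\<^sup>2 div 4) + 6 * m + 2 \<le> total_dist (lollipop_rel m) {..<m + 2}"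
proof -
  interpret symmetric_relation "lollipop_rel m" by unfold_locales (rule lollipop_rel_sym)
  let ?E = "lollipop_rel m" and ?X = "{..<m + 2}"
  have m: "Suc (m - 1) = m" using assms by simp
  have step: "(i, Suc i) \<in> ?E" if "Suc i < m + 2" for i
    using that assms by (cases "Suc i < m") (auto simp: lollipop_rel_def)
  have from_0: "(0, i) \<in> (Restr ?E ?X)\<^sup>* \<and> (i, 0) \<in> (Restr ?E ?X)\<^sup>*" if "i < m + 2" for i
    using that
  proof (induction i)
    case (Suc i)
    then have "(i, Suc i) \<in> Restr ?E ?X" "(Suc i, i) \<in> Restr ?E ?X" using step edge_sym by auto
    with Suc show ?case by (auto intro: rtrancl_into_rtrancl converse_rtrancl_into_rtrancl)
  qed simp
  have conn: "conn_on ?E ?X"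
    unfolding conn_on_def using from_0 rtrancl_trans by (metis lessThan_iff)
  let ?A = "{..<m}" and ?R = "{m - 1, m, m + 1}" and ?B = "{m - 1, m}" and ?C = "{m, m + 1}"
  have sp1: "splits ?E ?X ?A ?R (m - 1)"
    using assms by (auto simp: splits_def lollipop_rel_def)
  have sp2: "splits ?E ?R ?B ?C m"
    using assms by (auto simp: splits_def lollipop_rel_def)
  have cA: "conn_on ?E ?A" by (rule splits_conn[OF sp1 conn])
  have cR: "conn_on ?E ?R" by (rule splits_conn[OF splits_commute[OF sp1] conn])
  have cB: "conn_on ?E ?B" by (rule splits_conn[OF sp2 cR])
  have cC: "conn_on ?E ?C" by (rule splits_conn[OF splits_commute[OF sp2] cR])
  have card: "card ?A = Suc (m - 1)" "card ?B = Suc 1" "card ?C = Suc 1" "card ?R = Suc (1 + 1)"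
    using assms by (auto simp: card_insert_if)
  have tot: "S ?X = S ?A + S ?B + S ?C + 2 * (1 + 1) * D ?A (m - 1) + 2 * (m - 1) * D ?B (m - 1) + 2 * 1 * D ?B m
      + 2 * (1 + (m - 1)) * D ?C m + 2 * (m - 1) * 1 * d ?B (m - 1) m"
    by (rule splits_total_dist2[OF sp1 sp2 _ conn _ card]) simp_all
  have A: "m\<^sup>2 div 4 \<le> D ?A y" if "y \<in> ?A" for y
  proof -
    have "card {z\<in>?A. (x, z) \<in> ?E} \<le> 2" if "x \<in> ?A" for x
    proof -
      have "{z\<in>?A. (x, z) \<in> ?E} \<subseteq> {Suc x mod m, if x = 0 then m - 1 else x - 1}"
        using that by (auto simp: lollipop_rel_def mod_Suc split: if_splits)
      from card_mono[OF _ this] show ?thesis by (simp add: card_insert_if split: if_splits)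
    qed
    from transmission_ge[OF _ cA that this] show ?thesis by simp
  qed
  have pair: "1 \<le> D {p, q} y" if "conn_on ?E {p, q}" "y \<in> {p, q}" "p \<noteq> q" for p q y
  proof -
    have "card {z\<in>{p, q}. (x, z) \<in> ?E} \<le> 2" for x
      using card_mono[of "{p, q}" "{z\<in>{p, q}. (x, z) \<in> ?E}"] \<open>p \<noteq> q\<close> by (auto simp: numeral_2_eq_2)
    from transmission_ge[OF _ that(1,2) this] that(3) show ?thesis by (simp add: power2_eq_square)
  qed
  have "m * (m\<^sup>2 div 4) \<le> S ?A"
    unfolding total_dist_def using sum_bounded_below[of ?A "m\<^sup>2 div 4" "D ?A"] A by simp
  moreover have "2 \<le> S ?B"
    unfolding total_dist_def using pair[OF cB] m sum_bounded_below[of ?B 1 "D ?B"] by fastforce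
  moreover have "2 \<le> S ?C"
    unfolding total_dist_def using pair[OF cC] sum_bounded_below[of ?C 1 "D ?C"] by fastforce
  moreover have "1 \<le> D ?B m" using pair[OF cB, of m] m by simp
  moreover have "m\<^sup>2 div 4 \<le> D ?A (m - 1)" using A[of "m - 1"] assms by simp
  \<comment> \<open>Naming the products makes the final estimate linear.\<close>
  moreover define p q r where "p = (m - 1) * d ?B (m - 1) m" and "q = (m - 1) * D ?B (m - 1)" and "r = m * D ?C m"
  have "1 \<le> d ?B (m - 1) m"
    using dist_eq_0_iff[OF cB, of "m - 1" m] m by (simp add: Suc_le_eq)
  then have "m - 1 \<le> p" unfolding p_def by simp
  moreover have "m - 1 \<le> q"
    unfolding q_def using pair[OF cB, of "m - 1"] m by simp
  moreover have "m \<le> r"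
    unfolding r_def using pair[OF cC, of m] by simp
  moreover have "S ?X = S ?A + S ?B + S ?C + 4 * D ?A (m - 1) + 2 * q + 2 * D ?B m + 2 * r + 2 * p"
    unfolding p_def q_def r_def using tot m by simp
  moreover have "(m + 4) * (m\<^sup>2 div 4) = m * (m\<^sup>2 div 4) + 4 * (m\<^sup>2 div 4)" by (simp add: algebra_simps)
  ultimately show ?thesis by linarith
qed

text \<open>Appending \<open>v\<close> and \<open>e\<close> to a cyclic enumeration of
  \<open>A\<close> that ends at \<open>u\<close> gives \<open>u\<close> the index
  \<open>m - 1\<close>, as in the lollipop.\<close>

lemma (in symmetric_relation) cycle_with_tail_enum:
  assumes fin: "finite X" and irr: "irrefl E" and tail: "cycle_with_tail X A u v e" and card: "card A = m" "3 \<le> m"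
  obtains f where "bij_betw f {..<m + 2} X"
    "\<And>i j. \<lbrakk>i < m + 2; j < m + 2\<rbrakk> \<Longrightarrow> (f i, f j) \<in> E \<longleftrightarrow> (i, j) \<in> lollipop_rel m"
proof -
  have t: "X = insert v (insert e A)" "u \<in> A" "v \<notin> A" "e \<notin> A" "v \<noteq> e" "conn_on E A"
    "\<forall>y\<in>A. card ({x\<in>A. (y, x) \<in> E} - {y}) = 2" "(v, e) \<in> E"
    and tv: "\<And>x. x \<in> A \<Longrightarrow> (x, v) \<in> E \<longleftrightarrow> x = u" and te: "\<And>x. x \<in> A \<Longrightarrow> (x, e) \<notin> E"
    using tail unfolding cycle_with_tail_def by blast+
  have finA: "finite A" using fin t(1) by simp
  obtain xs where xs: "distinct xs" "set xs = A" "xs \<noteq> []" "last xs = u" and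
    edge: "\<And>i j. \<lbrakk>i < length xs; j < length xs; i \<noteq> j\<rbrakk> \<Longrightarrow>
      (xs ! i, xs ! j) \<in> E \<longleftrightarrow> j = Suc i mod length xs \<or> i = Suc j mod length xs"
    using two_regular_cycle[OF finA t(6,2,7)] by blast
  have len: "length xs = m" using xs card distinct_card by metis
  define ys where "ys = xs @ [v, e]"
  have ys: "distinct ys" "set ys = X" "length ys = m + 2"
    using xs t len by (auto simp: ys_def)
  have nth: "ys ! i = xs ! i" "xs ! i \<in> A" if "i < m" for i
    using that len xs(2) by (auto simp: ys_def nth_append)
  have nthv: "ys ! m = v" "ys ! Suc m = e" using len by (auto simp: ys_def nth_append)
  have last: "xs ! i = u \<longleftrightarrow> i = m - 1" if "i < m" for i
    using xs len that by (auto simp: last_conv_nth nth_eq_iff_index_eq)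
  have loop: "(x, x) \<notin> E" for x using irr by (simp add: irrefl_def)
  have lt: "(ys ! i, ys ! j) \<in> E \<longleftrightarrow> (i, j) \<in> lollipop_rel m" if "i < j" "j < m + 2" for i j
  proof -
    consider "j < m" | "i < m" "j = m" | "i < m" "j = Suc m" | "i = m" "j = Suc m" using \<open>i < j\<close> \<open>j < m + 2\<close> by linarith
    then show ?thesis
    proof cases
      case 1
      then show ?thesis
        using that nth edge[of i j] len by (auto simp: lollipop_rel_def)
    next
      case 2
      then show ?thesis using nth nthv tv last[of i] by (auto simp: lollipop_rel_def)
    next
      case 3
      then show ?thesis using nth nthv te by (auto simp: lollipop_rel_def)
    next
      case 4
      then show ?thesis using nthv t(8) by (auto simp: lollipop_rel_def)
    qed
  qed
  have "(ys ! i, ys ! j) \<in> E \<longleftrightarrow> (i, j) \<in> lollipop_rel m" if "i < m + 2" "j < m + 2" for i j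
  proof (cases i j rule: linorder_cases)
    case less
    then show ?thesis using lt that by simp
  next
    case equal
    have "Suc j mod m \<noteq> j" if "j < m" using that card(2) by (auto simp: mod_Suc)
    then have "(j, j) \<notin> lollipop_rel m" by (auto simp: lollipop_rel_def)
    then show ?thesis using equal loop by simp
  next
    case greater
    have "(i, j) \<in> lollipop_rel m \<longleftrightarrow> (j, i) \<in> lollipop_rel m"
      using lollipop_rel_sym by (auto dest: symD)
    then show ?thesis using lt[OF greater that(1)] edge_sym by blast
  qed
  moreover have "bij_betw ((!) ys) {..<m + 2} X"
    using ys by (intro bij_betw_nth) auto
  ultimately show ?thesis using that by blast
qed

lemma total_dist_image:
  assumes inj: "inj_on f X" and E: "E \<subseteq> X \<times> X"
  shows "total_dist (map_prod f f ` E) (f ` X) = total_dist E X"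
proof -
  let ?E = "map_prod f f ` E"
  have r: "(f x, f y) \<in> Restr ?E (f ` X) \<longleftrightarrow> (x, y) \<in> Restr E X" if "x \<in> X" "y \<in> X" for x y
  proof -
    have "(x, y) \<in> E" if "(a, b) \<in> E" "f x = f a" "f y = f b" for a b
      using inj_onD[OF inj that(2)] inj_onD[OF inj that(3)] E that(1) \<open>x \<in> X\<close> \<open>y \<in> X\<close> by auto
    then show ?thesis using that by auto
  qed
  have "(f x, f y) \<in> Restr ?E (f ` X) ^^ k \<longleftrightarrow> (x, y) \<in> Restr E X ^^ k" if "x \<in> X" "y \<in> X" for x y k
    using that(2)
  proof (induction k arbitrary: y)
    case 0
    then show ?case using inj that(1) by (auto dest: inj_onD)
  next
    case (Suc k)
    show ?case
    proof
      assume "(f x, f y) \<in> Restr ?E (f ` X) ^^ Suc k"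
      then obtain w where w: "(f x, w) \<in> Restr ?E (f ` X) ^^ k" "(w, f y) \<in> Restr ?E (f ` X)"
        by (rule relpow_Suc_E)
      then obtain z where "w = f z" "z \<in> X" by blast
      with w have "(x, z) \<in> Restr E X ^^ k" "(z, y) \<in> Restr E X"
        using Suc.IH[of z] r[of z y] Suc.prems by simp_all
      then show "(x, y) \<in> Restr E X ^^ Suc k" by (rule relpow_Suc_I)
    next
      assume "(x, y) \<in> Restr E X ^^ Suc k"
      then obtain z where z: "(x, z) \<in> Restr E X ^^ k" "(z, y) \<in> Restr E X"
        by (rule relpow_Suc_E)
      then have "z \<in> X" by blast
      with z have "(f x, f z) \<in> Restr ?E (f ` X) ^^ k" "(f z, f y) \<in> Restr ?E (f ` X)"
        using Suc.IH[of z] r[of z y] Suc.prems by simp_all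
      then show "(f x, f y) \<in> Restr ?E (f ` X) ^^ Suc k" by (rule relpow_Suc_I)
    qed
  qed
  then have "dist_in ?E (f ` X) (f x) (f y) = dist_in E X x y" if "x \<in> X" "y \<in> X" for x y
    unfolding dist_in_def using that by simp
  then show ?thesis
    unfolding total_dist_def transmission_def by (simp add: sum.reindex[OF inj])
qed

section \<open>Translation between digraphs and relations on vertex sets\<close>

lemma conn_on_Restr: "Y \<subseteq> X \<Longrightarrow> conn_on (Restr E X) Y \<longleftrightarrow> conn_on E Y"
proof -
  assume "Y \<subseteq> X"
  then have "Restr (Restr E X) Y = Restr E Y" by blast
  then show ?thesis by (simp add: conn_on_def)
qed

lemma rtrancl_on_eq_rtrancl_Restr:
  assumes "x \<in> X"
  shows "(x, y) \<in> rtrancl_on X E \<longleftrightarrow> (x, y) \<in> (Restr E X)\<^sup>*"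
proof
  show "(x, y) \<in> (Restr E X)\<^sup>*" if "(x, y) \<in> rtrancl_on X E"
    using that by (induction rule: rtrancl_on_induct) (auto intro: rtrancl_into_rtrancl)
  show "(x, y) \<in> rtrancl_on X E" if "(x, y) \<in> (Restr E X)\<^sup>*"
    using that by (induction rule: rtrancl_induct) (use assms in \<open>auto intro: rtrancl_on_into_rtrancl_on\<close>)
qed

lemma connected_iff_conn_on:
  assumes "wf_digraph G" "sym (arcs_ends G)"
  shows "connected G \<longleftrightarrow> verts G \<noteq> {} \<and> conn_on (arcs_ends G) (verts G)"
proof -
  interpret wf_digraph G by fact
  have "(arcs_ends G)\<^sup>s = arcs_ends G"
    using assms(2) by (auto simp: symcl_def sym_def)
  then show ?thesis
    unfolding connected_conv conn_on_def by (auto simp: rtrancl_on_eq_rtrancl_Restr)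
qed

lemma (in sym_digraph) sym_arcs_ends: "sym (arcs_ends G)"
  using sym_arcs by (simp add: symmetric_def)

lemma (in wf_digraph) arcs_ends_subset: "arcs_ends G \<subseteq> verts G \<times> verts G"
  by (auto simp: arcs_ends_def arc_to_ends_def)

text \<open>The conventions for a one-vertex graph agree: \<open>conn_on\<close> holds of the empty
  set, while \<open>cut_vertex\<close> excludes this case explicitly.\<close>

lemma (in graph) cut_vertex_iff_cut_at: "cut_vertex G w \<longleftrightarrow> cut_at (arcs_ends G) (verts G) w"
proof -
  let ?H = "del_vert w"
  interpret H: wf_digraph ?H by (rule wf_digraph_del_vert)
  have H: "arcs_ends ?H = Restr (arcs_ends G) (verts G - {w})"
    by (auto simp: arcs_ends_def arc_to_ends_def del_vert_simps)
  then have "sym (arcs_ends ?H)" using sym_arcs_ends by (auto simp: sym_def)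
  then have "connected ?H \<longleftrightarrow> verts G - {w} \<noteq> {} \<and> conn_on (arcs_ends G) (verts G - {w})"
    using connected_iff_conn_on[OF H.wf_digraph] by (simp add: H verts_del_vert conn_on_Restr)
  then show ?thesis
    unfolding cut_vertex_def cut_at_def by (auto simp: conn_on_def)
qed

lemma (in graph) wiener_index_total_dist: "2 * wiener_index G = total_dist (arcs_ends G) (verts G)"
proof -
  have "gdist G x y = dist_in (arcs_ends G) (verts G) x y" if "x \<in> verts G" for x y
    using that arcs_ends_subset
    unfolding gdist_eq_walk awalk_relpow dist_in_def by (simp add: Int_absorb2)
  then show ?thesis
    unfolding two_wiener_index total_dist_def transmission_def by simp
qed

lemma tail_lollipop: "tail (lollipop n g) = fst"
  and head_lollipop: "head (lollipop n g) = snd"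
  by (auto simp: lollipop_def union_def)

lemma arcs_lollipop:
  assumes "0 < m"
  shows "arcs (lollipop (m + 2) m) = lollipop_rel m"
  using assms by (cases m) (auto simp: lollipop_def lollipop_rel_def union_def cycle_graph_def path_graph_def)

lemma wiener_index_iso:
  assumes "graph G" "graph H" "digraph_iso G H"
  shows "wiener_index G = wiener_index H"
proof -
  interpret G: graph G by fact
  interpret H: graph H by fact
  obtain f where f: "G.digraph_isomorphism f" "H = app_iso f G"
    using assms(3) by (auto simp: digraph_iso_def)
  have "arcs_ends H = map_prod (iso_verts f) (iso_verts f) ` arcs_ends G"
    using f G.iso_verts_tail[OF f(1)] G.iso_verts_head[OF f(1)]
    by (simp add: arcs_ends_def arc_to_ends_def image_image)
  then have "2 * wiener_index H = 2 * wiener_index G"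
    unfolding H.wiener_index_total_dist G.wiener_index_total_dist
    using total_dist_image[OF G.digraph_isomorphism_inj_on_verts[OF f(1)] G.arcs_ends_subset] f(2) by simp
  then show ?thesis by simp
qed

text \<open>An isomorphism also has to map arcs. Without parallel arcs in \<open>G\<close>, sending
  an arc to the pair of images of its ends is injective.\<close>

lemma digraph_isoI:
  fixes H :: "('c, 'c \<times> 'c) pre_digraph"
  assumes "digraph G" and h: "bij_betw h (verts G) (verts H)"
    and arcs: "arcs H = map_prod h h ` arcs_ends G" and ends: "tail H = fst" "head H = snd"
  shows "digraph_iso G H"
proof -
  interpret digraph G by fact
  define f where "f = \<lparr>iso_verts = h, iso_arcs = (\<lambda>a. (h (tail G a), h (head G a))), iso_head = snd, iso_tail = fst\<rparr>"
  have inj: "inj_on h (verts G)" using h by (simp add: bij_betw_def)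
  have "inj_on (iso_arcs f) (arcs G)"
  proof (rule inj_onI)
    fix a b assume ab: "a \<in> arcs G" "b \<in> arcs G" and "iso_arcs f a = iso_arcs f b"
    then have "tail G a = tail G b" "head G a = head G b"
      using inj by (auto simp: f_def dest: inj_onD)
    then show "a = b" using ab no_multi_arcs by (simp add: arc_to_ends_def)
  qed
  then have "digraph_isomorphism f"
    unfolding digraph_isomorphism_def using inj wf_digraph by (simp add: f_def)
  moreover have "H = app_iso f G"
    using h arcs ends
    by (intro pre_digraph.equality) (auto simp: f_def bij_betw_def arcs_ends_def arc_to_ends_def image_image)
  ultimately show ?thesis unfolding digraph_iso_def by blast
qed

theorem theorem5p7:
  fixes n :: nat and G :: "('a,'b) pre_digraph"
  assumes "n \<ge> 10" and "G \<in> graphs_with_cut_vertices n 2"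
  shows "wiener_index G \<le> wiener_index (lollipop n (n - 2)) \<and>
    (wiener_index G = wiener_index (lollipop n (n - 2)) \<longleftrightarrow> digraph_iso G (lollipop n (n - 2)))"
proof -
  define m where "m = n - 2"
  have m: "n = m + 2" "8 \<le> m" using assms(1) by (auto simp: m_def)
  define L where "L = lollipop (m + 2) m"
  have G: "graph G" "connected G" "card (verts G) = m + 2" "card {v. cut_vertex G v} = 2"
    using assms(2) m(1) by (auto simp: graphs_with_cut_vertices_def)
  have L: "graph L" unfolding L_def using m(2) by (intro graph_lollipop) auto
  interpret G: graph G by (rule G(1))
  interpret L: graph L by (rule L)
  let ?E = "arcs_ends G" and ?X = "verts G" and ?T = "(m + 4) * (m\<^sup>2 div 4) + 6 * m + 2"
  interpret symmetric_relation ?E by unfold_locales (rule G.sym_arcs_ends)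
  have conn: "conn_on ?E ?X"
    using G(2) connected_iff_conn_on[OF G.wf_digraph G.sym_arcs_ends] by simp
  have "card {w. cut_at ?E ?X w} = 2" using G(4) by (simp add: G.cut_vertex_iff_cut_at)
  then obtain u v where cuts: "{w. cut_at ?E ?X w} = {u, v}" "u \<noteq> v" unfolding card_2_iff by auto
  note bound = two_cut_vertices[OF G.finite_verts conn cuts G(3) m(2)]
  have vL: "verts L = {..<m + 2}" unfolding L_def using m(2) by (intro verts_lollipop) auto
  have tL: "tail L = fst" "head L = snd" by (simp_all only: L_def tail_lollipop head_lollipop)
  have aL: "arcs L = lollipop_rel m" unfolding L_def using m(2) by (intro arcs_lollipop) simp
  then have "arcs_ends L = lollipop_rel m" by (simp add: arcs_ends_def arc_to_ends_def tL)
  then have "?T \<le> 2 * wiener_index L"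
    unfolding L.wiener_index_total_dist vL using lollipop_total_dist_ge[OF m(2)] by simp
  moreover have "2 * wiener_index G \<le> ?T"
    unfolding G.wiener_index_total_dist by (rule bound(1))
  \<comment> \<open>\<open>?T\<close> lies between the two doubled indices, so equal indices force
    \<open>G\<close> to attain the bound.\<close>
  ultimately have le: "wiener_index G \<le> wiener_index L"
    and eq: "wiener_index G = wiener_index L \<Longrightarrow> 2 * wiener_index G = ?T" by linarith+
  have "digraph_iso G L" if W: "wiener_index G = wiener_index L"
  proof -
    obtain A u v e where tail: "cycle_with_tail ?X A u v e"
      using bound(2) eq[OF W] G.wiener_index_total_dist by auto
    then have X: "?X = insert v (insert e A)" and veA: "v \<notin> A" "e \<notin> A" "v \<noteq> e"
      unfolding cycle_with_tail_def by blast+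
    have "finite A" using G.finite_verts unfolding X by simp
    then have "card (insert v (insert e A)) = card A + 2" using veA by simp
    then have cA: "card A = m" using G(3) unfolding X by linarith
    have irr: "irrefl ?E"
      using G.no_loops by (auto simp: irrefl_def arcs_ends_def arc_to_ends_def)
    have m3: "3 \<le> m" using m(2) by simp
    obtain f where f: "bij_betw f {..<m + 2} ?X"
      "\<And>i j. \<lbrakk>i < m + 2; j < m + 2\<rbrakk> \<Longrightarrow> (f i, f j) \<in> ?E \<longleftrightarrow> (i, j) \<in> lollipop_rel m"
      using cycle_with_tail_enum[OF G.finite_verts irr tail cA m3] by blast
    define h where "h = inv_into {..<m + 2} f"
    have h: "bij_betw h ?X (verts L)" unfolding h_def vL by (rule bij_betw_inv_into[OF f(1)])
    have hf: "h (f i) = i" if "i < m + 2" for i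
      using bij_betw_inv_into_left[OF f(1)] that by (simp add: h_def)
    have fh: "f (h x) = x" "h x < m + 2" if "x \<in> ?X" for x
      using bij_betw_inv_into_right[OF f(1) that] bij_betwE[OF h] that by (auto simp: h_def vL)
    have "arcs L = map_prod h h ` ?E"
    proof (intro set_eqI iffI)
      fix p assume p: "p \<in> arcs L"
      obtain i j where ij: "p = (i, j)" "i < m + 2" "j < m + 2"
        using p L.wellformed[OF p] unfolding vL by (cases p) (simp add: tL)
      then have "(f i, f j) \<in> ?E" using p f(2) aL by simp
      moreover have "p = map_prod h h (f i, f j)" using ij hf by simp
      ultimately show "p \<in> map_prod h h ` ?E" by (rule rev_image_eqI)
    next
      fix p assume "p \<in> map_prod h h ` ?E"
      then obtain x y where xy: "(x, y) \<in> ?E" "p = (h x, h y)" by auto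
      then have "x \<in> ?X" "y \<in> ?X" using G.arcs_ends_subset by auto
      then show "p \<in> arcs L" using xy f(2)[of "h x" "h y"] fh aL by simp
    qed
    then show ?thesis
      using digraph_isoI[OF G.digraph_axioms h] tL by simp
  qed
  moreover have "wiener_index G = wiener_index L" if "digraph_iso G L"
    by (rule wiener_index_iso[OF G(1) L that])
  ultimately show ?thesis using le m(1) by (auto simp: L_def)
qed

end
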